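(* For all $p\in\mathbb{C}$ with $0<|p|$ sufficiently small, \[3\,g(p)=n\!\left(\frac{27p}{(1+4p)^3}\right)+4\,n\!\left(\frac{27p^2}{(1-2p)^3}\right).\] Furthermore, for all $u\in\mathbb{C}$ with $0<|u|$ sufficiently small, \[3\,n\!\left(\frac{27u(1+u)^4}{2(1+4u+u^2)^3}\right)=g\!\left(\frac{u}{2(1+u)^2}\right)-8\,g\!\left(-\frac{u(1+u)}{2}\right)+4\,g\!\left(\frac{u^2}{4(1+u)}\right).\]
   Context: $\mathrm{m}$ is the logarithmic Mahler measure $\mathrm{m}(P)=\int_0^1\int_0^1\log|P(e^{2\pi i\theta_1},e^{2\pi i\theta_2})|d\theta_1d\theta_2$; $n(t)=\mathrm{m}\!\left(x^3+y^3+1-\frac{3}{t^{1/3}}xy\right)$ and $g(t)=\mathrm{m}\!\left((x+y)(x+1)(y+1)-\frac1t xy\right)$. *)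

theory Defs
  imports "HOL-Analysis.Analysis"
begin

definition mahler2 :: "(complex \<Rightarrow> complex \<Rightarrow> complex) \<Rightarrow> real" where
  "mahler2 P = (LINT t1:{0..1}|lborel. LINT t2:{0..1}|lborel.
      ln (cmod (P (cis (2 * pi * t1)) (cis (2 * pi * t2)))))"

text \<open>n(t) = m(x^3 + y^3 + 1 - 3 t^(-1/3) x y); principal cube root (the value is
  independent of the branch, since x \<mapsto> \<omega> x preserves the Mahler measure).\<close>
definition n_fun :: "complex \<Rightarrow> real" where
  "n_fun t = mahler2 (\<lambda>x y. x^3 + y^3 + 1 - (3 / (t powr (1/3))) * x * y)"

definition g_fun :: "complex \<Rightarrow> real" where
  "g_fun t = mahler2 (\<lambda>x y. (x + y) * (x + 1) * (y + 1) - (1 / t) * x * y)"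

end

theory Submission
  imports Defs "HOL-Complex_Analysis.Complex_Analysis"
begin

text \<open>
  Expanding the logarithm in the integrand gives, for small arguments,
  g(t) = - Re (log t + (\<Sum>n\<ge>1. a n * t^n / n)) and
  n(27 s) = - Re (log s + (\<Sum>n\<ge>1. f n * s^n / n)) / 3,
  where a n = (\<Sum>k\<le>n. (n choose k)^3) and f n = (3n)! / n!^3 are the constant terms of the
  powers of the two Laurent polynomials. Write A and F for the generating functions of a and f. Both
  identities follow from the two formulas
  A(z) = F(z^2 / (1 - 2z)^3) / (1 - 2z) = F(z / (1 + 4z)^3) / (1 + 4z)
  by logarithmic differentiation: in the first identity all the arguments pull back to A(p), in the
  second one all of them pull back to F(u^2 (1 + u)^2 / (4 (1 + u + u^2)^3)), and what remains is an
  identity between rational functions. The formula with 1 - 2z is MacMahon's binomial identity for the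
  Franel numbers; the right-hand side of the other one solves the same second-order differential
  equation, whose power series solutions are determined by their constant term.
\<close>

unbundle no vec_syntax

subsection \<open>The Franel differential equation\<close>

definition franel_fps :: "complex fps" where
  "franel_fps = Abs_fps (\<lambda>n. of_nat (\<Sum>k\<le>n. (n choose k) ^ 3))"

definition trinomial_fps :: "complex fps" where
  "trinomial_fps = Abs_fps (\<lambda>n. fact (3 * n) / fact n ^ 3)"

text \<open>Comparing coefficients turns the equation into the hypergeometric recurrence (m + 1)^2
  f(m + 1) = 3 (3 m + 1) (3 m + 2) f(m), which follows from the quotient of consecutive
  factorials.\<close>

lemma trinomial_fps_ode:
  fixes F defines "F \<equiv> trinomial_fps"
  shows "fps_X * (1 - 27 * fps_X) * fps_deriv (fps_deriv F) + (1 - 54 * fps_X) * fps_deriv F - 6 * F = 0"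
proof (rule fps_ext)
  fix n
  have rec: "F $ Suc m * of_nat (Suc m) ^ 2 = 3 * (3 * of_nat m + 1) * (3 * of_nat m + 2) * F $ m" for m
  proof -
    have "3 * Suc m = Suc (Suc (Suc (3 * m)))" by simp
    then have e: "fact (3 * Suc m) = (3 * of_nat m + 3) * ((3 * of_nat m + 2) * ((3 * of_nat m + 1) * (fact (3 * m) :: complex)))"
      by (simp only: fact_Suc) (simp add: algebra_simps)
    have "(of_nat m + 1 :: complex) \<noteq> 0" by (metis of_nat_Suc of_nat_neq_0 add.commute)
    then show ?thesis
      unfolding F_def trinomial_fps_def fps_nth_Abs_fps e fact_Suc of_nat_Suc
      by (simp add: divide_simps power3_eq_cube power2_eq_square) (simp add: algebra_simps)
  qed
  show "(fps_X * (1 - 27 * fps_X) * fps_deriv (fps_deriv F) + (1 - 54 * fps_X) * fps_deriv F - 6 * F) $ n = 0 $ n"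
  proof -
    have "fps_X * (1 - 27 * fps_X) * fps_deriv (fps_deriv F) + (1 - 54 * fps_X) * fps_deriv F - 6 * F
      = fps_X * fps_deriv (fps_deriv F) + fps_deriv F
        - 27 * (fps_X * (fps_X * fps_deriv (fps_deriv F))) - 54 * (fps_X * fps_deriv F) - 6 * F"
      by (simp add: algebra_simps)
    \<comment> \<open>The products with \<open>fps_X\<close> shift coefficients by at most two
      places, so n = 0 and n = 1 are separated from the general case.\<close>
    also have "\<dots> $ n = 0"
      using rec[of n]
      by (cases n; cases "n - 1")
         (simp_all add: numeral_fps_const algebra_simps power2_eq_square)
    finally show ?thesis by simp
  qed
qed

text \<open>This is the operator form of Franel's three-term recurrence (n + 1)^2 a(n + 1) = (7 n^2
  + 7 n + 2) a(n) + 8 n^2 a(n - 1).\<close>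

definition franel_ode :: "complex fps \<Rightarrow> complex fps" where
  "franel_ode H = fps_X * (1 - 7 * fps_X - 8 * fps_X ^ 2) * fps_deriv (fps_deriv H)
     + (1 - 14 * fps_X - 24 * fps_X ^ 2) * fps_deriv H - (2 + 8 * fps_X) * H"

lemma franel_ode_coeff:
  assumes "franel_ode H = 0"
  shows "of_nat (Suc n) ^ 2 * H $ Suc n
    = (7 * of_nat n ^ 2 + 7 * of_nat n + 2) * H $ n + (if n = 0 then 0 else 8 * of_nat n ^ 2 * H $ (n - 1))"
proof -
  have "franel_ode H = fps_X * fps_deriv (fps_deriv H) + fps_deriv H
     - 7 * (fps_X * (fps_X * fps_deriv (fps_deriv H))) - 14 * (fps_X * fps_deriv H) - 2 * H
     - 8 * (fps_X * (fps_X * (fps_X * fps_deriv (fps_deriv H)))) - 24 * (fps_X * (fps_X * fps_deriv H))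
     - 8 * (fps_X * H)"
    unfolding franel_ode_def by (simp add: algebra_simps power2_eq_square)
  then have "(fps_X * fps_deriv (fps_deriv H) + fps_deriv H
     - 7 * (fps_X * (fps_X * fps_deriv (fps_deriv H))) - 14 * (fps_X * fps_deriv H) - 2 * H
     - 8 * (fps_X * (fps_X * (fps_X * fps_deriv (fps_deriv H)))) - 24 * (fps_X * (fps_X * fps_deriv H))
     - 8 * (fps_X * H)) $ n = 0" using assms by simp
  then show ?thesis
    by (cases n; cases "n - 1"; cases "n - 2")
       (simp_all add: numeral_fps_const algebra_simps power2_eq_square)
qed

text \<open>The leading factor (n + 1)^2 of the recurrence never vanishes, and at n = 0 the term
  with index n - 1 is absent, so one initial value determines all coefficients of a power series
  solution of this second-order equation.\<close>

lemma franel_ode_unique: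
  assumes "franel_ode G = 0" "franel_ode H = 0" "G $ 0 = H $ 0"
  shows "G = H"
proof (rule fps_ext)
  fix n show "G $ n = H $ n"
  proof (induction n rule: less_induct)
    case (less n)
    show ?case
    proof (cases n)
      case (Suc m)
      have "of_nat (Suc m) ^ 2 * G $ Suc m = of_nat (Suc m) ^ 2 * H $ Suc m"
        unfolding franel_ode_coeff[OF assms(1)] franel_ode_coeff[OF assms(2)]
        using less Suc by simp
      then show ?thesis using Suc by (simp del: of_nat_Suc)
    qed (use assms in simp)
  qed
qed

section \<open>Pullbacks of the hypergeometric equation to the Franel equation\<close>

lemma trinomial_fps_ode_compose:
  fixes F S :: "complex fps"
  defines "F \<equiv> trinomial_fps"
  assumes S: "S $ 0 = 0"
  shows "S * (1 - 27 * S) * (fps_deriv (fps_deriv F) oo S) + (1 - 54 * S) * (fps_deriv F oo S) - 6 * (F oo S) = 0"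
proof -
  have "(fps_X * (1 - 27 * fps_X) * fps_deriv (fps_deriv F) + (1 - 54 * fps_X) * fps_deriv F - 6 * F) oo S = 0"
    unfolding F_def trinomial_fps_ode by simp
  then show ?thesis
    by (simp add: fps_compose_add_distrib fps_compose_sub_distrib fps_compose_mult_distrib S numeral_fps_const)
qed

text \<open>With S = X w^3, the series H = w F(S) and its first two derivatives are combinations of
  F(S), F'(S) and F''(S) whose coefficients are polynomials in X and w. The Franel operator applied
  to H then becomes (1 - 8 X) w^3 times the equation of F at S. The reciprocal w enters only through
  its defining relation, so that all computations are polynomial.\<close>

lemma franel_ode_cubic_pullback:
  fixes w :: "complex fps"
  assumes w: "w * (1 + 4 * fps_X) = 1"
  shows "franel_ode (w * (trinomial_fps oo (fps_X * w ^ 3))) = 0"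
proof -
  define S where "S = fps_X * w ^ 3"
  have S0: "S $ 0 = 0" by (simp add: S_def)
  define f0 f1 f2 where "f0 = trinomial_fps oo S" and "f1 = fps_deriv trinomial_fps oo S"
    and "f2 = fps_deriv (fps_deriv trinomial_fps) oo S"
  have ode: "S * (1 - 27 * S) * f2 + (1 - 54 * S) * f1 - 6 * f0 = 0"
    unfolding f0_def f1_def f2_def by (rule trinomial_fps_ode_compose[OF S0])
  have "fps_deriv (w * (1 + 4 * fps_X)) = 0" by (simp add: w)
  then have "w * (fps_deriv w * (1 + 4 * fps_X) + w * 4) = 0" by (simp add: algebra_simps)
  then have dw: "fps_deriv w = - 4 * w ^ 2" using w by algebra
  have df0: "fps_deriv f0 = f1 * fps_deriv S" and df1: "fps_deriv f1 = f2 * fps_deriv S"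
    unfolding f0_def f1_def f2_def using S0 by (simp_all add: fps_compose_deriv)
  have "fps_deriv S = w ^ 3 + fps_X * (3 * w ^ 2 * fps_deriv w)"
    unfolding S_def by (simp add: power2_eq_square power3_eq_cube algebra_simps)
  then have dS: "fps_deriv S = w ^ 4 * (1 - 8 * fps_X)"
    using w dw by algebra
  have dH: "fps_deriv (w * f0) = - 4 * w ^ 2 * f0 + w ^ 5 * (1 - 8 * fps_X) * f1"
    by (simp add: df0 dS dw) algebra
  have "fps_deriv (fps_deriv (w * f0)) = - 8 * w * fps_deriv w * f0 - 4 * w ^ 2 * fps_deriv f0
     + 5 * w ^ 4 * fps_deriv w * (1 - 8 * fps_X) * f1 - 8 * w ^ 5 * f1
     + w ^ 5 * (1 - 8 * fps_X) * fps_deriv f1"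
    unfolding dH by (simp add: fps_deriv_power algebra_simps power2_eq_square eval_nat_numeral)
  then have ddH: "fps_deriv (fps_deriv (w * f0)) = 32 * w ^ 3 * f0 - 4 * w ^ 6 * (1 - 8 * fps_X) * f1
     - 20 * w ^ 6 * (1 - 8 * fps_X) * f1 - 8 * w ^ 5 * f1 + w ^ 9 * (1 - 8 * fps_X) ^ 2 * f2"
    unfolding df0 df1 dS dw by algebra
  have w2: "w ^ 2 * (1 + 4 * fps_X) ^ 2 = 1" and w3: "w ^ 3 * (1 + 4 * fps_X) ^ 3 = 1"
    by (simp_all add: power_mult_distrib[symmetric] w)
  \<comment> \<open>The factorisation (1 + 4 X)^3 - 27 X = (1 + X) (1 - 8 X)^2 matches the singular
    points with those of the Franel equation, since 1 - 7 X - 8 X^2 = (1 + X) (1 - 8 X).\<close>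
  have "w ^ 3 * ((1 + fps_X) * (1 - 8 * fps_X) ^ 2) = w ^ 3 * (1 + 4 * fps_X) ^ 3 - 27 * S"
    unfolding S_def by algebra
  then have c2: "1 - 27 * S = w ^ 3 * ((1 + fps_X) * (1 - 8 * fps_X) ^ 2)"
    by (simp add: w3)
  have c1: "1 - 54 * S = w ^ 3 * ((1 + 4 * fps_X) ^ 3 - 54 * fps_X)"
    unfolding S_def right_diff_distrib w3 by (simp add: mult_ac)
  \<comment> \<open>The powers of w are made uniform: w^3 at f0, w^6 at f1 and w^9 at f2. After this
    the decisive equation holds identically in X and w, without the relation between them.\<close>
  have w_eq: "w = w ^ 3 * (1 + 4 * fps_X) ^ 2" "w ^ 2 = w ^ 3 * (1 + 4 * fps_X)"
       "w ^ 5 = w ^ 6 * (1 + 4 * fps_X)"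
    using w w2 by algebra+
  define H where "H = w * f0"
  have H: "H = w ^ 3 * (1 + 4 * fps_X) ^ 2 * f0"
    unfolding H_def using w_eq(1) by metis
  have H1: "fps_deriv H = - 4 * (w ^ 3 * (1 + 4 * fps_X)) * f0
       + w ^ 6 * (1 + 4 * fps_X) * (1 - 8 * fps_X) * f1"
    unfolding H_def dH unfolding w_eq(2,3) ..
  have H2: "fps_deriv (fps_deriv H) = 32 * w ^ 3 * f0 - 4 * w ^ 6 * (1 - 8 * fps_X) * f1
     - 20 * w ^ 6 * (1 - 8 * fps_X) * f1 - 8 * (w ^ 6 * (1 + 4 * fps_X)) * f1
     + w ^ 9 * (1 - 8 * fps_X) ^ 2 * f2"
    unfolding H_def ddH unfolding w_eq(3) ..
  have "franel_ode H = fps_X * (1 - 7 * fps_X - 8 * fps_X ^ 2) * fps_deriv (fps_deriv H)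
     + (1 - 14 * fps_X - 24 * fps_X ^ 2) * fps_deriv H - (2 + 8 * fps_X) * H"
    by (rule franel_ode_def)
  also have "\<dots> = (1 - 8 * fps_X) * w ^ 3 * (S * (w ^ 3 * ((1 + fps_X) * (1 - 8 * fps_X) ^ 2)) * f2
     + (w ^ 3 * ((1 + 4 * fps_X) ^ 3 - 54 * fps_X)) * f1 - 6 * f0)"
    unfolding H2 unfolding H1 unfolding H S_def by algebra
  also have "\<dots> = 0"
    unfolding c1[symmetric] c2[symmetric] ode by simp
  finally show ?thesis unfolding H_def f0_def S_def .
qed

text \<open>The argument is that of the cubic pullback. Now (1 - 2 X)^3 - 27 X^2 = (1 + X)^2 (1 - 8
  X), and the multiplier of the equation of F is 4 X (1 + X) w^3.\<close>

lemma franel_ode_macmahon_pullback: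
  fixes w :: "complex fps"
  assumes w: "w * (1 - 2 * fps_X) = 1"
  shows "franel_ode (w * (trinomial_fps oo (fps_X ^ 2 * w ^ 3))) = 0"
proof -
  define S where "S = fps_X ^ 2 * w ^ 3"
  have S0: "S $ 0 = 0" by (simp add: S_def)
  define f0 f1 f2 where "f0 = trinomial_fps oo S" and "f1 = fps_deriv trinomial_fps oo S"
    and "f2 = fps_deriv (fps_deriv trinomial_fps) oo S"
  have ode: "S * (1 - 27 * S) * f2 + (1 - 54 * S) * f1 - 6 * f0 = 0"
    unfolding f0_def f1_def f2_def by (rule trinomial_fps_ode_compose[OF S0])
  have "fps_deriv (w * (1 - 2 * fps_X)) = 0" by (simp add: w)
  then have "w * (fps_deriv w * (1 - 2 * fps_X) - w * 2) = 0" by (simp add: algebra_simps)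
  then have dw: "fps_deriv w = 2 * w ^ 2" using w by algebra
  have df0: "fps_deriv f0 = f1 * fps_deriv S" and df1: "fps_deriv f1 = f2 * fps_deriv S"
    unfolding f0_def f1_def f2_def using S0 by (simp_all add: fps_compose_deriv)
  have "fps_deriv S = 2 * fps_X * w ^ 3 + fps_X ^ 2 * (3 * w ^ 2 * fps_deriv w)"
    unfolding S_def by (simp add: power2_eq_square power3_eq_cube algebra_simps)
  then have dS: "fps_deriv S = 2 * fps_X * (1 + fps_X) * w ^ 4"
    using w dw by algebra
  have dH: "fps_deriv (w * f0) = 2 * w ^ 2 * f0 + 2 * fps_X * (1 + fps_X) * w ^ 5 * f1"
    by (simp add: df0 dS dw) algebra
  have "fps_deriv (fps_deriv (w * f0)) = 4 * w * fps_deriv w * f0 + 2 * w ^ 2 * fps_deriv f0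
     + (2 + 4 * fps_X) * w ^ 5 * f1 + 10 * fps_X * (1 + fps_X) * w ^ 4 * fps_deriv w * f1
     + 2 * fps_X * (1 + fps_X) * w ^ 5 * fps_deriv f1"
    unfolding dH by (simp add: fps_deriv_power algebra_simps power2_eq_square eval_nat_numeral)
  then have ddH: "fps_deriv (fps_deriv (w * f0)) = 8 * w ^ 3 * f0
     + 24 * fps_X * (1 + fps_X) * w ^ 6 * f1 + (2 + 4 * fps_X) * w ^ 5 * f1
     + 4 * fps_X ^ 2 * (1 + fps_X) ^ 2 * w ^ 9 * f2"
    unfolding df0 df1 dS dw by algebra
  have w2: "w ^ 2 * (1 - 2 * fps_X) ^ 2 = 1" and w3: "w ^ 3 * (1 - 2 * fps_X) ^ 3 = 1"
    by (simp_all add: power_mult_distrib[symmetric] w)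
  have "w ^ 3 * ((1 + fps_X) ^ 2 * (1 - 8 * fps_X)) = w ^ 3 * (1 - 2 * fps_X) ^ 3 - 27 * S"
    unfolding S_def by algebra
  then have c2: "1 - 27 * S = w ^ 3 * ((1 + fps_X) ^ 2 * (1 - 8 * fps_X))"
    by (simp add: w3)
  have c1: "1 - 54 * S = w ^ 3 * ((1 - 2 * fps_X) ^ 3 - 54 * fps_X ^ 2)"
    unfolding S_def right_diff_distrib w3 by (simp add: mult_ac)
  have w_eq: "w = w ^ 3 * (1 - 2 * fps_X) ^ 2" "w ^ 2 = w ^ 3 * (1 - 2 * fps_X)"
       "w ^ 5 = w ^ 6 * (1 - 2 * fps_X)"
    using w w2 by algebra+
  define H where "H = w * f0"
  have H: "H = w ^ 3 * (1 - 2 * fps_X) ^ 2 * f0"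
    unfolding H_def using w_eq(1) by metis
  have H1: "fps_deriv H = 2 * (w ^ 3 * (1 - 2 * fps_X)) * f0
       + 2 * fps_X * (1 + fps_X) * (w ^ 6 * (1 - 2 * fps_X)) * f1"
    unfolding H_def dH unfolding w_eq(2,3) ..
  have H2: "fps_deriv (fps_deriv H) = 8 * w ^ 3 * f0
     + 24 * fps_X * (1 + fps_X) * w ^ 6 * f1 + (2 + 4 * fps_X) * (w ^ 6 * (1 - 2 * fps_X)) * f1
     + 4 * fps_X ^ 2 * (1 + fps_X) ^ 2 * w ^ 9 * f2"
    unfolding H_def ddH unfolding w_eq(3) ..
  have "franel_ode H = fps_X * (1 - 7 * fps_X - 8 * fps_X ^ 2) * fps_deriv (fps_deriv H)
     + (1 - 14 * fps_X - 24 * fps_X ^ 2) * fps_deriv H - (2 + 8 * fps_X) * H"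
    by (rule franel_ode_def)
  also have "\<dots> = 4 * fps_X * (1 + fps_X) * w ^ 3 * (S * (w ^ 3 * ((1 + fps_X) ^ 2 * (1 - 8 * fps_X))) * f2
     + (w ^ 3 * ((1 - 2 * fps_X) ^ 3 - 54 * fps_X ^ 2)) * f1 - 6 * f0)"
    unfolding H2 unfolding H1 unfolding H S_def by algebra
  also have "\<dots> = 0"
    unfolding c1[symmetric] c2[symmetric] ode by simp
  finally show ?thesis unfolding H_def f0_def S_def .
qed

subsection \<open>MacMahon's identity\<close>

text \<open>A case of the Pfaff--Saalschuetz summation; Vandermonde's identity, applied three times, suffices.\<close>
lemma binomial_square_eq_sum:
  "(k + m choose k) ^ 2 = (\<Sum>j\<le>min k m. (k choose j) * (m choose j) * (k + m + j choose j))"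
proof -
  \<comment> \<open>The product (k choose j) (j choose i) equals (k choose i) (k - i choose j - i);
    reflecting the last factor leaves a Vandermonde sum over j.\<close>
  have inner: "(\<Sum>j\<le>k. (k choose j) * (j choose i) * (m choose j)) = (k choose i) * (k + m - i choose k)" if "i \<le> k" for i
  proof -
    have "(\<Sum>j\<le>k. (k choose j) * (j choose i) * (m choose j)) = (\<Sum>j=i..k. (k choose j) * (j choose i) * (m choose j))"
      by (rule sum.mono_neutral_right) auto
    also have "\<dots> = (\<Sum>j=i..k. (k choose i) * ((m choose j) * (k - i choose (k - j))))"
    proof (rule sum.cong)
      fix j assume j: "j \<in> {i..k}"
      then have "(k choose j) * (j choose i) = (k choose i) * (k - i choose (j - i))"
        by (intro choose_mult) auto
      also have "k - i choose (j - i) = k - i choose (k - j)"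
        using j binomial_symmetric[of "j - i" "k - i"] by (auto simp: diff_le_mono)
      finally show "(k choose j) * (j choose i) * (m choose j) = (k choose i) * ((m choose j) * (k - i choose (k - j)))"
        by simp
    qed simp
    also have "\<dots> = (k choose i) * (\<Sum>j=i..k. (m choose j) * (k - i choose (k - j)))"
      by (simp add: sum_distrib_left)
    also have "(\<Sum>j=i..k. (m choose j) * (k - i choose (k - j))) = (\<Sum>j\<le>k. (m choose j) * (k - i choose (k - j)))"
      using that by (intro sum.mono_neutral_left) (auto simp: binomial_eq_0)
    also have "\<dots> = k + m - i choose k"
      using vandermonde[of m "k - i" k] that by (simp add: add.commute)
    finally show ?thesis .
  qed
  have "(\<Sum>j\<le>min k m. (k choose j) * (m choose j) * (k + m + j choose j))
      = (\<Sum>j\<le>k. (k choose j) * (m choose j) * (k + m + j choose j))"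
    by (rule sum.mono_neutral_left) auto
  also have "\<dots> = (\<Sum>j\<le>k. \<Sum>i\<le>k. (k choose j) * (m choose j) * ((k + m choose i) * (j choose i)))"
  proof (rule sum.cong)
    fix j assume j: "j \<in> {..k}"
    have "k + m + j choose j = (\<Sum>i\<le>j. (k + m choose i) * (j choose (j - i)))"
      by (rule vandermonde[symmetric])
    also have "\<dots> = (\<Sum>i\<le>j. (k + m choose i) * (j choose i))"
      by (intro sum.cong refl) (simp add: binomial_symmetric[symmetric])
    also have "\<dots> = (\<Sum>i\<le>k. (k + m choose i) * (j choose i))"
      using j by (intro sum.mono_neutral_left) auto
    finally show "(k choose j) * (m choose j) * (k + m + j choose j)
        = (\<Sum>i\<le>k. (k choose j) * (m choose j) * ((k + m choose i) * (j choose i)))"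
      by (simp add: sum_distrib_left)
  qed simp
  also have "\<dots> = (\<Sum>i\<le>k. \<Sum>j\<le>k. (k choose j) * (m choose j) * ((k + m choose i) * (j choose i)))"
    by (rule sum.swap)
  also have "\<dots> = (\<Sum>i\<le>k. (k + m choose i) * (\<Sum>j\<le>k. (k choose j) * (j choose i) * (m choose j)))"
    by (simp add: sum_distrib_left mult_ac)
  also have "\<dots> = (\<Sum>i\<le>k. (k + m choose k) * ((m choose i) * (k choose (k - i))))"
  proof (rule sum.cong)
    fix i assume i: "i \<in> {..k}"
    \<comment> \<open>For i \<le> m both sides are the multinomial coefficient (k + m)! / (i! k! (m
      - i)!); for i > m both vanish.\<close>
    have "(k + m choose i) * (k + m - i choose k) = (k + m choose k) * (m choose i)"
    proof (cases "i \<le> m")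
      case True
      have "k + m - i choose k = k + m - i choose (m - i)"
        using True binomial_symmetric[of k "k + m - i"] by simp
      then have "(k + m choose i) * (k + m - i choose k) = (k + m choose m) * (m choose i)"
        using choose_mult[of i m "k + m"] True by simp
      then show ?thesis using binomial_symmetric[of k "k + m"] by simp
    qed (use i in \<open>auto simp: binomial_eq_0\<close>)
    then show "(k + m choose i) * (\<Sum>j\<le>k. (k choose j) * (j choose i) * (m choose j))
        = (k + m choose k) * ((m choose i) * (k choose (k - i)))"
      using i binomial_symmetric[of i k] by (simp add: inner)
  qed simp
  also have "\<dots> = (k + m choose k) ^ 2"
    using vandermonde[of m k k] by (simp add: sum_distrib_left[symmetric] power2_eq_square add.commute)
  finally show ?thesis by simp
qed

text \<open>The square identity with m = n - k is multiplied by (n choose k). Each term is then (n +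
  j)! / (j!^3 (k - j)! (n - k - j)!), regrouped so that k occurs only in the last binomial
  coefficient. The conditionals make the range of j independent of k and guard against truncated
  subtraction.\<close>

lemma binomial_cube_eq_sum:
  assumes "k \<le> n"
  shows "(n choose k) ^ 3 = (\<Sum>j\<le>n. if 2 * j \<le> n then
     (n + j choose (3 * j)) * (3 * j choose j) * (2 * j choose j) * (if j \<le> k then n - 2 * j choose (k - j) else 0) else 0)"
proof -
  define m where "m = n - k"
  have n: "n = k + m" using assms by (simp add: m_def)
  have "(n choose k) ^ 3 = (\<Sum>j\<le>min k m. (n choose k) * ((k choose j) * (m choose j) * (n + j choose j)))"
    unfolding sum_distrib_left[symmetric] n binomial_square_eq_sum[symmetric]
    by (simp add: power3_eq_cube power2_eq_square)
  also have "\<dots> = (\<Sum>j\<le>min k m. 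
     (n + j choose (3 * j)) * (3 * j choose j) * (2 * j choose j) * (n - 2 * j choose (k - j)))"
  proof (rule sum.cong)
    fix j assume "j \<in> {..min k m}"
    then obtain a b where ab: "k = j + a" "m = j + b" by (metis atMost_iff le_iff_add min.bounded_iff)
    have e: "n + j = 3 * j + (a + b)" "n = (j + a) + (j + b)" "n - 2 * j = a + b" "k - j = a" "2 * j = j + j" "3 * j = j + 2 * j"
      by (auto simp: n ab)
    have B: "(x + y choose x) = fact (x + y) / (fact x * fact y :: real)" for x y
      using binomial_fact[of x "x + y", where ?'a = real] by simp
    have "real ((n choose k) * ((k choose j) * (m choose j) * (n + j choose j))) = fact (n + j) / (fact j ^ 3 * fact a * fact b)"
      unfolding of_nat_mult B[of k m, folded n] B[of j a, folded ab] B[of j b, folded ab] add.commute[of n] B[of j n]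
      by (simp add: power3_eq_cube)
    also have "\<dots> = real ((n + j choose (3 * j)) * (3 * j choose j) * (2 * j choose j) * (n - 2 * j choose (k - j)))"
      unfolding of_nat_mult e(3,4) B[of "3 * j" "a + b", folded e(1)] B[of j "2 * j", folded e(6)]
        B[of j j, folded e(5)] B[of a b]
      by (simp add: power3_eq_cube)
    finally show "(n choose k) * ((k choose j) * (m choose j) * (n + j choose j))
      = (n + j choose (3 * j)) * (3 * j choose j) * (2 * j choose j) * (n - 2 * j choose (k - j))"
      by (simp only: of_nat_eq_iff)
  qed simp
  also have "\<dots> = (\<Sum>j\<le>n. if 2 * j \<le> n then
     (n + j choose (3 * j)) * (3 * j choose j) * (2 * j choose j) * (if j \<le> k then n - 2 * j choose (k - j) else 0) else 0)"
    using n by (intro sum.mono_neutral_cong_left) (auto simp: binomial_eq_0)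
  finally show ?thesis .
qed

text \<open>After exchanging the sums, the sum over k runs through a full row of Pascal's triangle
  and gives the power of 2.\<close>

lemma franel_eq_sum:
  "(\<Sum>k\<le>n. (n choose k) ^ 3) = (\<Sum>j\<le>n. if 2 * j \<le> n then
     (n + j choose (3 * j)) * (3 * j choose j) * (2 * j choose j) * 2 ^ (n - 2 * j) else 0)"
proof -
  have "(\<Sum>k\<le>n. (n choose k) ^ 3) = (\<Sum>k\<le>n. \<Sum>j\<le>n. if 2 * j \<le> n then
     (n + j choose (3 * j)) * (3 * j choose j) * (2 * j choose j) * (if j \<le> k then n - 2 * j choose (k - j) else 0) else 0)"
    by (intro sum.cong) (simp_all add: binomial_cube_eq_sum)
  also have "\<dots> = (\<Sum>j\<le>n. \<Sum>k\<le>n. if 2 * j \<le> n then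
     (n + j choose (3 * j)) * (3 * j choose j) * (2 * j choose j) * (if j \<le> k then n - 2 * j choose (k - j) else 0) else 0)"
    by (rule sum.swap)
  also have "\<dots> = (\<Sum>j\<le>n. if 2 * j \<le> n then
     (n + j choose (3 * j)) * (3 * j choose j) * (2 * j choose j) * 2 ^ (n - 2 * j) else 0)"
  proof (intro sum.cong refl)
    fix j
    have "(\<Sum>k\<le>n. if j \<le> k then n - 2 * j choose (k - j) else 0) = 2 ^ (n - 2 * j)" if "2 * j \<le> n"
    proof -
      have "(\<Sum>k\<le>n. if j \<le> k then n - 2 * j choose (k - j) else 0) = (\<Sum>i\<le>n-2*j. n - 2 * j choose i)"
      proof -
        \<comment> \<open>Terms with k < j are zero by the guard, those with k > n - j because the
          lower index exceeds the upper one.\<close>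
        have "(\<Sum>k\<le>n. if j \<le> k then n - 2 * j choose (k - j) else 0) = (\<Sum>k=j..n-j. n - 2 * j choose (k - j))"
          using that by (intro sum.mono_neutral_cong_right) (auto simp: binomial_eq_0)
        also have "\<dots> = (\<Sum>i\<le>n-2*j. n - 2 * j choose i)"
          using that by (intro sum.reindex_bij_witness[of _ "\<lambda>i. i + j" "\<lambda>k. k - j"]) auto
        finally show ?thesis .
      qed
      then show ?thesis by (simp add: choose_row_sum)
    qed
    then show "(\<Sum>k\<le>n. if 2 * j \<le> n then
      (n + j choose (3 * j)) * (3 * j choose j) * (2 * j choose j) * (if j \<le> k then n - 2 * j choose (k - j) else 0) else 0)
      = (if 2 * j \<le> n then (n + j choose (3 * j)) * (3 * j choose j) * (2 * j choose j) * 2 ^ (n - 2 * j) else 0)"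
      by (simp add: sum_distrib_left[symmetric])
  qed
  finally show ?thesis .
qed

text \<open>Since S^j has no terms of degree below j, the sum over j in every coefficient up to n
  can be cut off at the same bound n, and finite sums may be exchanged.\<close>

lemma fps_mult_compose_nth:
  fixes F S w :: "complex fps"
  assumes "S $ 0 = 0"
  shows "(w * (F oo S)) $ n = (\<Sum>j\<le>n. F $ j * (w * S ^ j) $ n)"
proof -
  have "(F oo S) $ l = (\<Sum>j\<le>n. F $ j * (S ^ j) $ l)" if "l \<le> n" for l
    unfolding fps_compose_nth using that assms startsby_zero_power_prefix[of S]
    by (intro sum.mono_neutral_left) auto
  then have "(w * (F oo S)) $ n = (\<Sum>i=0..n. w $ i * (\<Sum>j\<le>n. F $ j * (S ^ j) $ (n - i)))"
    by (simp add: fps_mult_nth)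
  also have "\<dots> = (\<Sum>i=0..n. \<Sum>j\<le>n. F $ j * (w $ i * (S ^ j) $ (n - i)))"
    by (simp add: sum_distrib_left mult_ac)
  also have "\<dots> = (\<Sum>j\<le>n. \<Sum>i=0..n. F $ j * (w $ i * (S ^ j) $ (n - i)))"
    by (rule sum.swap)
  finally show ?thesis by (simp add: fps_mult_nth sum_distrib_left)
qed

text \<open>The j-th term of the composition contains X^(2 j) / (1 - 2 X)^(3 j + 1). By the negative
  binomial series its n-th coefficient is (n + j choose 3 j) 2^(n - 2 j), and
  \<open>franel_eq_sum\<close> matches the sum over j.\<close>

lemma franel_fps_macmahon:
  "franel_fps = inverse (1 - 2 * fps_X) * (trinomial_fps oo (fps_X ^ 2 * inverse (1 - 2 * fps_X) ^ 3))"
    (is "_ = ?w * (_ oo ?S)")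
proof (rule fps_ext)
  fix n
  have coeff: "trinomial_fps $ j * (?w * ?S ^ j) $ n
      = of_nat (if 2 * j \<le> n then (n + j choose (3 * j)) * (3 * j choose j) * (2 * j choose j) * 2 ^ (n - 2 * j) else 0)" for j
  proof -
    have S: "?w * ?S ^ j = fps_X ^ (2 * j) * inverse ((1 - fps_const 2 * fps_X) ^ (3 * j + 1))"
      by (simp add: power_mult_distrib power_mult[symmetric] fps_inverse_power fps_inverse_mult numeral_fps_const mult_ac)
    have "trinomial_fps $ j = of_nat ((3 * j choose j) * (2 * j choose j))"
      using binomial_fact[of j "3 * j", where ?'a = complex] binomial_fact[of j "2 * j", where ?'a = complex]
      by (simp add: trinomial_fps_def power3_eq_cube)
    moreover have "(?w * ?S ^ j) $ n = of_nat (if 2 * j \<le> n then (n + j choose (3 * j)) * 2 ^ (n - 2 * j) else 0)"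
    proof (cases "2 * j \<le> n")
      case True
      have "3 * j + 1 + (n - 2 * j) - 1 = n + j" "n - 2 * j \<le> n + j" "n + j - (n - 2 * j) = 3 * j"
        using True by auto
      then have "(3 * j + 1 + (n - 2 * j) - 1) choose (n - 2 * j) = n + j choose (3 * j)"
        using binomial_symmetric[of "n - 2 * j" "n + j"] by (simp only:)
      then show ?thesis
        unfolding S using True by (subst one_minus_const_fps_X_neg_power') (auto simp: fps_X_power_mult_nth)
    qed (simp add: S fps_X_power_mult_nth)
    ultimately show ?thesis by simp
  qed
  show "franel_fps $ n = (?w * (trinomial_fps oo ?S)) $ n"
    unfolding franel_fps_def fps_nth_Abs_fps franel_eq_sum
    by (subst fps_mult_compose_nth) (simp_all only: coeff of_nat_sum, simp)
qed

subsection \<open>Identities between the logarithmic primitives\<close>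

text \<open>Both sides solve the Franel equation and have constant term 1; for
  \<open>franel_fps\<close> the equation is read off from its MacMahon form.\<close>

lemma franel_fps_cubic:
  "franel_fps = inverse (1 + 4 * fps_X) * (trinomial_fps oo (fps_X * inverse (1 + 4 * fps_X) ^ 3))"
proof (rule franel_ode_unique)
  show "franel_ode franel_fps = 0"
    by (subst franel_fps_macmahon, rule franel_ode_macmahon_pullback, rule inverse_mult_eq_1) simp
  show "franel_ode (inverse (1 + 4 * fps_X) * (trinomial_fps oo (fps_X * inverse (1 + 4 * fps_X) ^ 3))) = 0"
    by (rule franel_ode_cubic_pullback, rule inverse_mult_eq_1) simp
qed (simp add: franel_fps_def trinomial_fps_def)

section \<open>Substitution into the two formulas for the Franel series\<close>

lemma fps_eq_inverseI:
  fixes a b :: "complex fps" assumes "a * b = 1" shows "a = inverse b"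
proof -
  have "a $ 0 * b $ 0 = 1" using arg_cong[OF assms, of "\<lambda>f. f $ 0"] by simp
  then have "b $ 0 \<noteq> 0" by auto
  then show ?thesis using assms by (metis fps_inverse_unique mult.commute)
qed

text \<open>The reciprocal of 1 - 2 P is a parameter v with a polynomial relation, so that it can be
  supplied in whatever form suits later computations.\<close>

lemma franel_compose_macmahon:
  assumes P: "P $ 0 = 0" and v: "v * (1 - 2 * P) = 1"
  shows "franel_fps oo P = v * (trinomial_fps oo (P ^ 2 * v ^ 3))"
proof -
  have "inverse (1 - 2 * fps_X) oo P = inverse (1 - 2 * P)"
    using P by (simp add: fps_inverse_compose fps_compose_sub_distrib fps_compose_mult_distrib numeral_fps_const)
  moreover have "v = inverse (1 - 2 * P)" using v by (rule fps_eq_inverseI)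
  ultimately show ?thesis
    using P by (subst franel_fps_macmahon)
      (simp add: fps_compose_mult_distrib fps_compose_assoc[symmetric] fps_compose_power[symmetric])
qed

lemma franel_compose_cubic:
  assumes P: "P $ 0 = 0" and v: "v * (1 + 4 * P) = 1"
  shows "franel_fps oo P = v * (trinomial_fps oo (P * v ^ 3))"
proof -
  have "inverse (1 + 4 * fps_X) oo P = inverse (1 + 4 * P)"
    using P by (simp add: fps_inverse_compose fps_compose_add_distrib fps_compose_mult_distrib numeral_fps_const)
  moreover have "v = inverse (1 + 4 * P)" using v by (rule fps_eq_inverseI)
  ultimately show ?thesis
    using P by (subst franel_fps_cubic)
      (simp add: fps_compose_mult_distrib fps_compose_assoc[symmetric] fps_compose_power[symmetric])
qed

text \<open>The coefficient at 0 is 0, because division by zero gives zero.\<close>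
definition fps_logint :: "complex fps \<Rightarrow> complex fps" where
  "fps_logint F = Abs_fps (\<lambda>n. F $ n / of_nat n)"

section \<open>Logarithmic derivatives of composed series\<close>

lemma fps_X_deriv_logint: "fps_X * fps_deriv (fps_logint F) = F - fps_const (F $ 0)"
proof (rule fps_ext)
  fix n show "(fps_X * fps_deriv (fps_logint F)) $ n = (F - fps_const (F $ 0)) $ n"
    by (cases n) (simp_all add: fps_logint_def del: of_nat_Suc)
qed

lemma fps_logint_nth_0 [simp]: "fps_logint F $ 0 = 0"
  by (simp add: fps_logint_def)

text \<open>Here d stands for the logarithmic derivative X P' / P. As P is not invertible, d is
  given by a product equation, and P is cancelled at the end in the integral domain of power
  series.\<close>

lemma deriv_logint_compose:
  assumes P: "P $ 0 = 0" "P \<noteq> 0" and d: "fps_X * fps_deriv P = P * d"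
  shows "fps_X * fps_deriv (fps_logint F oo P) = ((F oo P) - fps_const (F $ 0)) * d"
proof -
  have "P * (fps_deriv (fps_logint F) oo P) = (F oo P) - fps_const (F $ 0)"
    using arg_cong[OF fps_X_deriv_logint[of F], of "\<lambda>f. f oo P"] P
    by (simp add: fps_compose_mult_distrib fps_compose_sub_distrib)
  then have "P * (fps_X * fps_deriv (fps_logint F oo P)) = P * (((F oo P) - fps_const (F $ 0)) * d)"
    using d unfolding fps_compose_deriv[OF P(1)] by algebra
  then show ?thesis using P(2) by simp
qed

lemma deriv_ln_compose:
  assumes P: "P $ 0 = 0" and v: "v * (1 + P) = 1"
  shows "fps_deriv (fps_ln 1 oo P) = v * fps_deriv (P :: complex fps)"
proof -
  have "v = inverse (1 + P)" using v by (rule fps_eq_inverseI)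
  then show ?thesis
    using P by (simp add: fps_compose_deriv fps_ln_deriv fps_inverse_compose fps_compose_add_distrib)
qed

lemma fps_eq_0I:
  fixes K :: "complex fps"
  assumes "fps_X * fps_deriv K = 0" "K $ 0 = 0"
  shows "K = 0"
  using assms by (metis fps_X_neq_zero fps_const_0_eq_0 fps_deriv_eq_0_iff mult_eq_0_iff)

lemma fps_ln_nth_0 [simp]: "fps_ln c $ 0 = 0"
  by (simp add: fps_ln_def)

text \<open>This is the first identity multiplied by -3 with the logarithms of the arguments split
  up; the multiples of log p cancel because 9 = 1 + 4 * 2. It is proved by applying X d/dX and
  comparing constant terms.\<close>

lemma fps_logint_identity_1:
  fixes LA LF :: "complex fps"
  defines "LA \<equiv> fps_logint franel_fps" and "LF \<equiv> fps_logint trinomial_fps"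
  defines "w1 \<equiv> inverse (1 + 4 * fps_X)" and "w2 \<equiv> inverse (1 - 2 * fps_X)"
  shows "9 * LA - (LF oo (fps_X * w1 ^ 3)) - 4 * (LF oo (fps_X ^ 2 * w2 ^ 3))
     + 3 * (fps_ln 1 oo (4 * fps_X)) + 12 * (fps_ln 1 oo (- (2 * fps_X))) = 0" (is "?K = 0")
proof (rule fps_eq_0I)
  define A where "A = franel_fps"
  define F where "F = trinomial_fps"
  have c0: "A $ 0 = 1" "F $ 0 = 1" by (simp_all add: A_def F_def franel_fps_def trinomial_fps_def)
  have w1: "w1 * (1 + 4 * fps_X) = 1" and w2: "w2 * (1 - 2 * fps_X) = 1"
    unfolding w1_def w2_def by (rule inverse_mult_eq_1; simp)+
  have "w1 \<noteq> 0" "w2 \<noteq> 0" using w1 w2 by auto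
  have "fps_deriv w1 * (1 + 4 * fps_X) + w1 * 4 = 0" "fps_deriv w2 * (1 - 2 * fps_X) - w2 * 2 = 0"
    using arg_cong[OF w1, of fps_deriv] arg_cong[OF w2, of fps_deriv] by (simp_all add: algebra_simps)
  then have dw1: "fps_deriv w1 = - 4 * w1 ^ 2" and dw2: "fps_deriv w2 = 2 * w2 ^ 2"
    using w1 w2 by algebra+
  have d1: "fps_X * fps_deriv (fps_X * w1 ^ 3) = (fps_X * w1 ^ 3) * (w1 * (1 - 8 * fps_X))"
    by (simp add: fps_deriv_power dw1 numeral_3_eq_3) (use w1 in algebra)
  have d2: "fps_X * fps_deriv (fps_X ^ 2 * w2 ^ 3) = (fps_X ^ 2 * w2 ^ 3) * (2 * w2 * (1 + fps_X))"
    by (simp add: fps_deriv_power dw2 numeral_3_eq_3 power2_eq_square) (use w2 in algebra)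
  have A1: "A = w1 * (F oo (fps_X * w1 ^ 3))" and A2: "A = w2 * (F oo (fps_X ^ 2 * w2 ^ 3))"
    using franel_fps_macmahon franel_fps_cubic unfolding A_def F_def w1_def w2_def by simp_all
  have L1: "fps_X * fps_deriv (LF oo (fps_X * w1 ^ 3)) = ((F oo (fps_X * w1 ^ 3)) - 1) * (w1 * (1 - 8 * fps_X))"
    unfolding LF_def F_def using \<open>w1 \<noteq> 0\<close> c0 by (subst deriv_logint_compose[OF _ _ d1]) (simp_all add: F_def)
  have L2: "fps_X * fps_deriv (LF oo (fps_X ^ 2 * w2 ^ 3)) = ((F oo (fps_X ^ 2 * w2 ^ 3)) - 1) * (2 * w2 * (1 + fps_X))"
    unfolding LF_def F_def using \<open>w2 \<noteq> 0\<close> c0 by (subst deriv_logint_compose[OF _ _ d2]) (simp_all add: F_def)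
  have L3: "fps_X * fps_deriv LA = A - 1"
    unfolding LA_def fps_X_deriv_logint using c0 by (simp add: A_def)
  have N1: "fps_deriv (fps_ln 1 oo (4 * fps_X)) = w1 * 4"
    using w1 by (subst deriv_ln_compose[where v = w1]) simp_all
  have N2: "fps_deriv (fps_ln 1 oo (- (2 * fps_X))) = w2 * - 2"
    using w2 by (subst deriv_ln_compose[where v = w2]) simp_all
  have "fps_X * fps_deriv ?K = 9 * (fps_X * fps_deriv LA) - fps_X * fps_deriv (LF oo (fps_X * w1 ^ 3))
    - 4 * (fps_X * fps_deriv (LF oo (fps_X ^ 2 * w2 ^ 3))) + 3 * fps_X * fps_deriv (fps_ln 1 oo (4 * fps_X))
    + 12 * fps_X * fps_deriv (fps_ln 1 oo (- (2 * fps_X)))"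
    by (simp add: algebra_simps)
  \<comment> \<open>By \<open>A1\<close> and \<open>A2\<close> everything is expressed through A,
    whose total factor is 9 - (1 - 8 X) - 8 (1 + X) = 0. The remaining terms are -9 + w1 (1 + 4 X) +
    8 w2 (1 - 2 X) = -9 + 1 + 8.\<close>
  also have "\<dots> = 0"
    unfolding L1 L2 L3 N1 N2 using A1 A2 w1 w2 by algebra
  finally show "fps_X * fps_deriv ?K = 0" .
qed (simp add: LA_def LF_def numeral_fps_const)

text \<open>The second identity is treated in the same way. In log s - log p1 + 8 log p2 - 4 log p3
  the terms log u and log (1/2) cancel, and 18 log (1 + u) - 3 log (1 + 4 u + u^2) remains.\<close>

lemma fps_logint_identity_2:
  fixes LA LF :: "complex fps"
  defines "LA \<equiv> fps_logint franel_fps" and "LF \<equiv> fps_logint trinomial_fps"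
  defines "w \<equiv> inverse (1 + fps_X)" and "q \<equiv> inverse (1 + 4 * fps_X + fps_X ^ 2)"
  defines "h \<equiv> fps_const (1 / 2 :: complex)"
  shows "(LF oo (h * fps_X * (1 + fps_X) ^ 4 * q ^ 3)) - (LA oo (h * fps_X * w ^ 2))
     + 8 * (LA oo (- (h * fps_X * (1 + fps_X)))) - 4 * (LA oo (h ^ 2 * fps_X ^ 2 * w))
     + 18 * (fps_ln 1 oo fps_X) - 3 * (fps_ln 1 oo (4 * fps_X + fps_X ^ 2)) = 0" (is "?K = 0")
proof (rule fps_eq_0I)
  define A where "A = franel_fps"
  define F where "F = trinomial_fps"
  define c :: "complex fps" where "c = inverse (1 + fps_X + fps_X ^ 2)"
  define s p1 p2 p3 where "s = h * fps_X * (1 + fps_X) ^ 4 * q ^ 3" and "p1 = h * fps_X * w ^ 2"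
    and "p2 = - (h * fps_X * (1 + fps_X))" and "p3 = h ^ 2 * fps_X ^ 2 * w"
  have c0: "A $ 0 = 1" "F $ 0 = 1" by (simp_all add: A_def F_def franel_fps_def trinomial_fps_def)
  have h: "2 * h = 1" by (simp add: h_def numeral_fps_const)
  have w: "w * (1 + fps_X) = 1" and q: "q * (1 + 4 * fps_X + fps_X ^ 2) = 1"
    and c: "c * (1 + fps_X + fps_X ^ 2) = 1"
    unfolding w_def q_def c_def by (rule inverse_mult_eq_1; simp)+
  have nz: "w \<noteq> 0" "q \<noteq> 0" "h \<noteq> 0" "1 + fps_X \<noteq> (0 :: complex fps)" using w q h by auto
  have p0: "s $ 0 = 0" "p1 $ 0 = 0" "p2 $ 0 = 0" "p3 $ 0 = 0"
    by (simp_all add: s_def p1_def p2_def p3_def)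
  have pnz: "s \<noteq> 0" "p1 \<noteq> 0" "p2 \<noteq> 0" "p3 \<noteq> 0"
    using nz by (simp_all add: s_def p1_def p2_def p3_def)
  have "fps_deriv w * (1 + fps_X) + w = 0"
      "fps_deriv q * (1 + 4 * fps_X + fps_X ^ 2) + q * (4 + 2 * fps_X) = 0"
    using arg_cong[OF w, of fps_deriv] arg_cong[OF q, of fps_deriv]
    by (simp_all add: algebra_simps power2_eq_square)
  then have dw: "fps_deriv w = - (w ^ 2)" and dq: "fps_deriv q = - ((4 + 2 * fps_X) * q ^ 2)"
    using w q by algebra+
  have dh: "fps_deriv h = 0" by (simp add: h_def)
  have "fps_deriv s = h * ((1 + fps_X) ^ 4 * q ^ 3 + fps_X * (4 * (1 + fps_X) ^ 3) * q ^ 3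
       + fps_X * (1 + fps_X) ^ 4 * (3 * q ^ 2 * fps_deriv q))"
    unfolding s_def by (simp add: dh fps_deriv_power eval_nat_numeral) (simp add: algebra_simps)
  then have "fps_deriv s = h * (1 + fps_X) ^ 3 * q ^ 3 * ((1 + fps_X) + 4 * fps_X
       - 3 * fps_X * (1 + fps_X) * (4 + 2 * fps_X) * q)"
    unfolding dq by algebra
  \<comment> \<open>This rests on (1 + 5 X) (1 + 4 X + X^2) - 3 X (1 + X) (4 + 2 X) = (1 -
    X)^3.\<close>
  moreover have "(1 + fps_X) + 4 * fps_X - 3 * fps_X * (1 + fps_X) * (4 + 2 * fps_X) * q = q * (1 - fps_X) ^ 3"
    using q by algebra
  ultimately have "fps_X * fps_deriv s = fps_X * (h * (1 + fps_X) ^ 3 * q ^ 3 * (q * (1 - fps_X) ^ 3))"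
    by simp
  also have "\<dots> = s * (w * q * (1 - fps_X) ^ 3)"
  proof -
    have "(1 + fps_X) ^ 3 = (1 + fps_X) ^ 4 * w" using w by algebra
    then show ?thesis unfolding s_def by (simp only: mult_ac)
  qed
  finally have ds: "fps_X * fps_deriv s = s * (w * q * (1 - fps_X) ^ 3)" .
  have d1: "fps_X * fps_deriv p1 = p1 * (w * (1 - fps_X))"
    unfolding p1_def by (simp add: dh dw power2_eq_square) (use w in algebra)
  have d2: "fps_X * fps_deriv p2 = p2 * (w * (1 + 2 * fps_X))"
    unfolding p2_def by (simp add: dh power2_eq_square) (use w in algebra)
  have d3: "fps_X * fps_deriv p3 = p3 * (w * (2 + fps_X))"
    unfolding p3_def by (simp add: dh dw power2_eq_square) (use w in algebra)
  \<comment> \<open>S is the common argument: MacMahon's formula at p1 and p2 and the cubic formula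
    at p3 all lead to F(S).\<close>
  define S where "S = h ^ 2 * fps_X ^ 2 * (1 + fps_X) ^ 2 * c ^ 3"
  have "(1 + fps_X) ^ 2 * c * (1 - 2 * p1) = 1"
    unfolding p1_def using w c h by algebra
  then have "A oo p1 = (1 + fps_X) ^ 2 * c * (F oo (p1 ^ 2 * ((1 + fps_X) ^ 2 * c) ^ 3))"
    unfolding A_def F_def by (rule franel_compose_macmahon[OF p0(2)])
  also have "p1 ^ 2 * ((1 + fps_X) ^ 2 * c) ^ 3 = h ^ 2 * fps_X ^ 2 * (1 + fps_X) ^ 2 * c ^ 3 * (w * (1 + fps_X)) ^ 4"
    unfolding p1_def by algebra
  finally have A1: "A oo p1 = (1 + fps_X) ^ 2 * c * (F oo S)" by (simp add: w S_def)
  have "c * (1 - 2 * p2) = 1"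
    unfolding p2_def using c h by algebra
  then have "A oo p2 = c * (F oo (p2 ^ 2 * c ^ 3))"
    unfolding A_def F_def by (rule franel_compose_macmahon[OF p0(3)])
  also have "p2 ^ 2 * c ^ 3 = S"
    unfolding p2_def S_def by algebra
  finally have A2: "A oo p2 = c * (F oo S)" .
  have "(1 + fps_X) * c * (1 + 4 * p3) = 1"
    unfolding p3_def using w c h by algebra
  then have "A oo p3 = (1 + fps_X) * c * (F oo (p3 * ((1 + fps_X) * c) ^ 3))"
    unfolding A_def F_def by (rule franel_compose_cubic[OF p0(4)])
  also have "p3 * ((1 + fps_X) * c) ^ 3 = h ^ 2 * fps_X ^ 2 * (1 + fps_X) ^ 2 * c ^ 3 * (w * (1 + fps_X))"
    unfolding p3_def by algebra
  finally have A3: "A oo p3 = (1 + fps_X) * c * (F oo S)" by (simp add: w S_def)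
  \<comment> \<open>The cubic formula at p1 leads to F(s) instead. Comparing it with MacMahon's
    formula at the same point connects F(s) with F(S).\<close>
  have "(1 + fps_X) ^ 2 * q * (1 + 4 * p1) = 1"
    unfolding p1_def using w q h by algebra
  then have "A oo p1 = (1 + fps_X) ^ 2 * q * (F oo (p1 * ((1 + fps_X) ^ 2 * q) ^ 3))"
    unfolding A_def F_def by (rule franel_compose_cubic[OF p0(2)])
  also have "p1 * ((1 + fps_X) ^ 2 * q) ^ 3 = s * (w * (1 + fps_X)) ^ 2"
    unfolding p1_def s_def by algebra
  finally have "A oo p1 = (1 + fps_X) ^ 2 * q * (F oo s)" by (simp add: w)
  with A1 have "(1 + fps_X) ^ 2 * (q * (F oo s)) = (1 + fps_X) ^ 2 * (c * (F oo S))"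
    by (simp add: mult_ac)
  then have qF: "q * (F oo s) = c * (F oo S)" using nz by simp
  have Ls: "fps_X * fps_deriv (LF oo s) = ((F oo s) - 1) * (w * q * (1 - fps_X) ^ 3)"
    using deriv_logint_compose[OF p0(1) pnz(1) ds, of F] c0 by (simp add: LF_def F_def)
  have L1: "fps_X * fps_deriv (LA oo p1) = ((A oo p1) - 1) * (w * (1 - fps_X))"
    using deriv_logint_compose[OF p0(2) pnz(2) d1, of A] c0 by (simp add: LA_def A_def)
  have L2: "fps_X * fps_deriv (LA oo p2) = ((A oo p2) - 1) * (w * (1 + 2 * fps_X))"
    using deriv_logint_compose[OF p0(3) pnz(3) d2, of A] c0 by (simp add: LA_def A_def)
  have L3: "fps_X * fps_deriv (LA oo p3) = ((A oo p3) - 1) * (w * (2 + fps_X))"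
    using deriv_logint_compose[OF p0(4) pnz(4) d3, of A] c0 by (simp add: LA_def A_def)
  have N1: "fps_deriv (fps_ln 1 oo fps_X) = w"
    using w by (subst deriv_ln_compose[where v = w]) simp_all
  have N2: "fps_deriv (fps_ln 1 oo (4 * fps_X + fps_X ^ 2)) = q * (4 + 2 * fps_X)"
    using q by (subst deriv_ln_compose[where v = q]) (simp_all add: add.assoc power2_eq_square)
  have "fps_X * fps_deriv ((LF oo s) - (LA oo p1) + 8 * (LA oo p2) - 4 * (LA oo p3)
       + 18 * (fps_ln 1 oo fps_X) - 3 * (fps_ln 1 oo (4 * fps_X + fps_X ^ 2)))
     = fps_X * fps_deriv (LF oo s) - fps_X * fps_deriv (LA oo p1) + 8 * (fps_X * fps_deriv (LA oo p2))
       - 4 * (fps_X * fps_deriv (LA oo p3)) + 18 * fps_X * fps_deriv (fps_ln 1 oo fps_X)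
       - 3 * fps_X * fps_deriv (fps_ln 1 oo (4 * fps_X + fps_X ^ 2))"
    by (simp add: algebra_simps del: fps_compose_fps_X)
  also have "\<dots> = w * (1 - fps_X) ^ 3 * (q * (F oo s) - q)
       - ((1 + fps_X) ^ 2 * c * (F oo S) - 1) * (w * (1 - fps_X))
       + 8 * ((c * (F oo S) - 1) * (w * (1 + 2 * fps_X)))
       - 4 * (((1 + fps_X) * c * (F oo S) - 1) * (w * (2 + fps_X))) + 18 * fps_X * w
       - 3 * fps_X * (q * (4 + 2 * fps_X))"
    unfolding Ls L1 L2 L3 N1 N2 A1 A2 A3 by (simp add: algebra_simps)
  \<comment> \<open>The factor of w c F(S) is (1 - X)^3 - (1 - X) (1 + X)^2 + 8 (1 + 2 X) - 4 (1 +
    X) (2 + X) = 0. What remains vanishes by the polynomial identity already used for the derivative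
    of s.\<close>
  also have "\<dots> = w * (1 + 5 * fps_X) - q * (w * (1 - fps_X) ^ 3 + 6 * fps_X * (2 + fps_X))"
    unfolding qF by algebra
  also have "\<dots> = 0" using w q by algebra
  finally show "fps_X * fps_deriv ?K = 0" unfolding s_def p1_def p2_def p3_def .
qed (simp add: LA_def LF_def numeral_fps_const)

subsection \<open>Series expansion of the Mahler measures\<close>

abbreviation unit_interval :: "real measure" where
  "unit_interval \<equiv> restrict_space lborel {0..1}"

lemma set_integral_unit_interval:
  fixes f :: "real \<Rightarrow> 'b :: {banach, second_countable_topology}"
  shows "(LINT t:{0..1}|lborel. f t) = integral\<^sup>L unit_interval f"
  by (subst integral_restrict_space) (simp_all add: set_lebesgue_integral_def)

lemma finite_measure_unit_interval: "finite_measure unit_interval"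
  by (rule finite_measureI) (simp add: emeasure_restrict_space)

lemma measure_unit_interval [simp]: "measure unit_interval {0..1} = 1"
  by (subst measure_restrict_space) auto

lemma space_unit_interval [simp]: "space unit_interval = {0..1}"
  by (simp add: space_restrict_space)

lemma integrable_unit_interval_bounded:
  fixes f :: "real \<Rightarrow> complex"
  assumes "f \<in> borel_measurable unit_interval" "\<And>t. norm (f t) \<le> b"
  shows "integrable unit_interval f"
  using finite_measure.integrable_const_bound[OF finite_measure_unit_interval, of f b] assms by simp

lemma norm_integral_unit_interval_le:
  fixes f :: "real \<Rightarrow> complex"
  assumes "f \<in> borel_measurable unit_interval" "\<And>t. norm (f t) \<le> b"
  shows "norm (integral\<^sup>L unit_interval f) \<le> b"
proof -
  interpret finite_measure unit_interval by (rule finite_measure_unit_interval)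
  have "norm (integral\<^sup>L unit_interval f) \<le> (\<integral>t. b \<partial>unit_interval)"
    using assms by (intro Bochner_Integration.integral_norm_bound_integral integrable_unit_interval_bounded[where b = b]) auto
  then show ?thesis by simp
qed

lemma sums_integral_unit_interval:
  fixes f :: "nat \<Rightarrow> real \<Rightarrow> complex"
  assumes meas: "\<And>n. f n \<in> borel_measurable unit_interval"
    and bound: "\<And>n t. norm (f n t) \<le> b n" and "summable b"
    and sums: "\<And>t. (\<lambda>n. f n t) sums g t"
  shows "(\<lambda>n. integral\<^sup>L unit_interval (f n)) sums integral\<^sup>L unit_interval g"
proof -
  interpret finite_measure unit_interval by (rule finite_measure_unit_interval)
  have int: "integrable unit_interval (f n)" for n
    using meas bound by (rule integrable_unit_interval_bounded)
  have "(\<lambda>n. integral\<^sup>L unit_interval (f n)) sums (\<integral>t. (\<Sum>n. f n t) \<partial>unit_interval)"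
  proof (rule sums_integral[OF int])
    show "AE t in unit_interval. summable (\<lambda>n. norm (f n t))"
      by (intro AE_I2 summable_comparison_test'[OF \<open>summable b\<close>]) (simp add: bound)
    have "norm (\<integral>t. norm (f n t) \<partial>unit_interval) \<le> b n" for n
    proof -
      have "(\<integral>t. norm (f n t) \<partial>unit_interval) \<le> (\<integral>t. b n \<partial>unit_interval)"
        using int bound by (intro integral_mono) auto
      then show ?thesis by simp
    qed
    then show "summable (\<lambda>n. \<integral>t. norm (f n t) \<partial>unit_interval)"
      by (intro summable_comparison_test'[OF \<open>summable b\<close>]) auto
  qed
  moreover have "(\<lambda>t. \<Sum>n. f n t) = g"
    using sums by (auto simp: sums_iff)
  ultimately show ?thesis by simp
qed

lemma ln_cmod_eq_Re_Ln: "cmod z < 1 \<Longrightarrow> ln (cmod (1 - z)) = Re (Ln (1 - z))"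
  by (subst Re_Ln) auto

text \<open>The logarithmic series of 1 - z q is dominated by the geometric series with ratio |z| B
  < 1, so it may be integrated term by term in each variable. The integrability statements serve to
  split a constant off the iterated integral.\<close>

lemma torus_log_series:
  fixes q :: "real \<Rightarrow> real \<Rightarrow> complex"
  assumes cont: "continuous_on UNIV (\<lambda>(s, t). q s t)"
    and bound: "\<And>s t. cmod (q s t) \<le> B" and z: "cmod z * B < 1"
  shows "(\<lambda>n. (\<integral>s. \<integral>t. q s t ^ n \<partial>unit_interval \<partial>unit_interval) / of_nat n * z ^ n) sums
      - (\<integral>s. \<integral>t. Ln (1 - z * q s t) \<partial>unit_interval \<partial>unit_interval)"
    and "(\<integral>s. \<integral>t. ln (cmod (1 - z * q s t)) \<partial>unit_interval \<partial>unit_interval)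
      = Re (\<integral>s. \<integral>t. Ln (1 - z * q s t) \<partial>unit_interval \<partial>unit_interval)"
    and "\<And>s. integrable unit_interval (\<lambda>t. ln (cmod (1 - z * q s t)))"
    and "integrable unit_interval (\<lambda>s. \<integral>t. ln (cmod (1 - z * q s t)) \<partial>unit_interval)"
proof -
  let ?U = unit_interval
  interpret finite_measure ?U by (rule finite_measure_unit_interval)
  have B: "B \<ge> 0" using bound[of 0 0] norm_ge_zero order_trans by blast
  define r where "r = cmod z * B"
  have r: "0 \<le> r" "r < 1" using B z by (auto simp: r_def)
  have zq: "cmod (z * q s t) \<le> r" for s t
    unfolding r_def norm_mult by (intro mult_left_mono bound) auto
  have "(\<lambda>p. (fst p, snd p)) \<in> measurable (?U \<Otimes>\<^sub>M ?U) (borel \<Otimes>\<^sub>M borel :: (real \<times> real) measure)"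
    by (intro measurable_Pair measurable_compose[OF measurable_fst] measurable_compose[OF measurable_snd]
          measurable_restrict_space1) simp_all
  then have pair: "(\<lambda>p. p) \<in> measurable (?U \<Otimes>\<^sub>M ?U) (borel :: (real \<times> real) measure)"
    by (simp add: borel_prod)
  \<comment> \<open>Joint measurability is what makes the inner integrals measurable in s.\<close>
  have q2: "(\<lambda>p. q (fst p) (snd p)) \<in> borel_measurable (?U \<Otimes>\<^sub>M ?U)"
    using measurable_compose[OF pair borel_measurable_continuous_onI[OF cont]] by (simp add: split_beta)
  have q1: "q s \<in> borel_measurable ?U" for s
  proof -
    have "continuous_on UNIV (\<lambda>t. q s t)"
      using continuous_on_compose2[OF cont, of UNIV "\<lambda>t. (s, t)"] by (simp add: continuous_intros)
    then show ?thesis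
      by (intro measurable_restrict_space1) (simp add: borel_measurable_continuous_onI)
  qed
  define f where "f = (\<lambda>n s t. q s t ^ n / of_nat n * z ^ n)"
  have f_bound: "cmod (f n s t) \<le> r ^ n" for n s t
  \<comment> \<open>The term with n = 0 is zero, as division by zero gives zero.\<close>
  proof (cases n)
    case (Suc m)
    have "cmod (f n s t) = cmod (z * q s t) ^ n / real n"
      by (simp add: f_def norm_mult norm_divide norm_power power_mult_distrib)
    also have "\<dots> \<le> r ^ n / 1"
      using zq[of s t] r Suc by (intro frac_le power_mono) auto
    finally show ?thesis by simp
  qed (simp add: f_def)
  have f_sums: "(\<lambda>n. f n s t) sums - Ln (1 - z * q s t)" for s t
  proof -
    have "(\<lambda>n. - ((- (- (z * q s t))) ^ n) / of_nat n) sums ln (1 + - (z * q s t))"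
      using zq[of s t] r by (intro Ln_series') simp
    from sums_minus[OF this] show ?thesis by (simp add: f_def power_mult_distrib mult.commute)
  qed
  have f1: "f n s \<in> borel_measurable ?U" for n s
    unfolding f_def using q1 by measurable
  have f2: "(\<lambda>s. \<integral>t. f n s t \<partial>?U) \<in> borel_measurable ?U" for n
  proof (rule borel_measurable_lebesgue_integral)
    have "(\<lambda>p. f n (fst p) (snd p)) \<in> borel_measurable (?U \<Otimes>\<^sub>M ?U)"
      unfolding f_def using q2 by measurable
    then show "(\<lambda>(s, t). f n s t) \<in> borel_measurable (?U \<Otimes>\<^sub>M ?U)"
      by (simp add: split_beta)
  qed
  have sum_r: "summable (\<lambda>n. r ^ n)" using r by (intro summable_geometric) simp
  have inner: "(\<lambda>n. \<integral>t. f n s t \<partial>?U) sums (\<integral>t. - Ln (1 - z * q s t) \<partial>?U)" for s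
    by (rule sums_integral_unit_interval[OF f1 f_bound sum_r f_sums])
  have "(\<lambda>n. \<integral>s. \<integral>t. f n s t \<partial>?U \<partial>?U) sums (\<integral>s. \<integral>t. - Ln (1 - z * q s t) \<partial>?U \<partial>?U)"
    by (rule sums_integral_unit_interval[OF f2 norm_integral_unit_interval_le[OF f1 f_bound] sum_r inner])
  then show "(\<lambda>n. (\<integral>s. \<integral>t. q s t ^ n \<partial>?U \<partial>?U) / of_nat n * z ^ n) sums
      - (\<integral>s. \<integral>t. Ln (1 - z * q s t) \<partial>?U \<partial>?U)"
    by (simp add: f_def)
  have L_bound: "cmod (Ln (1 - z * q s t)) \<le> 1 / (1 - r)" for s t
  proof -
    have "cmod (\<Sum>n. f n s t) \<le> (\<Sum>n. r ^ n)"
      by (rule norm_suminf_le[OF f_bound sum_r])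
    then show ?thesis using f_sums[of s t] r by (simp add: sums_iff suminf_geometric)
  qed
  have L1: "(\<lambda>t. Ln (1 - z * q s t)) \<in> borel_measurable ?U" for s
    using q1[of s] by measurable
  have L2: "(\<lambda>s. \<integral>t. Ln (1 - z * q s t) \<partial>?U) \<in> borel_measurable ?U"
  proof (rule borel_measurable_lebesgue_integral)
    have "(\<lambda>p. Ln (1 - z * q (fst p) (snd p))) \<in> borel_measurable (?U \<Otimes>\<^sub>M ?U)"
      using q2 by measurable
    then show "(\<lambda>(s, t). Ln (1 - z * q s t)) \<in> borel_measurable (?U \<Otimes>\<^sub>M ?U)"
      by (simp add: split_beta)
  qed
  have ln_eq: "ln (cmod (1 - z * q s t)) = Re (Ln (1 - z * q s t))" for s t
    using zq[of s t] r by (intro ln_cmod_eq_Re_Ln) simp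
  have int1: "integrable ?U (\<lambda>t. Ln (1 - z * q s t))" for s
    by (rule integrable_unit_interval_bounded[OF L1 L_bound])
  have int2: "integrable ?U (\<lambda>s. \<integral>t. Ln (1 - z * q s t) \<partial>?U)"
    by (rule integrable_unit_interval_bounded[OF L2 norm_integral_unit_interval_le[OF L1 L_bound]])
  show "(\<integral>s. \<integral>t. ln (cmod (1 - z * q s t)) \<partial>?U \<partial>?U) = Re (\<integral>s. \<integral>t. Ln (1 - z * q s t) \<partial>?U \<partial>?U)"
    and "\<And>s. integrable ?U (\<lambda>t. ln (cmod (1 - z * q s t)))"
    and "integrable ?U (\<lambda>s. \<integral>t. ln (cmod (1 - z * q s t)) \<partial>?U)"
    unfolding ln_eq using int1 int2 by simp_all
qed

section \<open>Torus means as constant terms of Laurent polynomials\<close>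

lemma integral_cis:
  fixes k :: int
  shows "(\<integral>t. cis (2 * pi * of_int k * t) \<partial>unit_interval) = (if k = 0 then 1 else 0)"
proof (cases "k = 0")
  case False
  let ?a = "2 * pi * of_int k :: real"
  have a: "?a \<noteq> 0" using False by simp
  have "(\<integral>t. cis (?a * t) \<partial>unit_interval) = (\<integral>t. indicator {0..1} t *\<^sub>R cis (?a * t) \<partial>lborel)"
    by (subst integral_restrict_space) auto
  also have "\<dots> = cis (?a * 1) / (\<i> * of_real ?a) - cis (?a * 0) / (\<i> * of_real ?a)"
  proof (rule integral_FTC_atLeastAtMost)
    fix x :: real
    have "((\<lambda>t. exp (\<i> * of_real ?a * of_real t) / (\<i> * of_real ?a)) has_vector_derivative
       exp (\<i> * of_real ?a * of_real x)) (at x within {0..1})"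
      using a by (auto intro!: derivative_eq_intros has_vector_derivative_real_field)
    then show "((\<lambda>t. cis (?a * t) / (\<i> * of_real ?a)) has_vector_derivative cis (?a * x)) (at x within {0..1})"
      by (simp add: cis_conv_exp mult_ac)
  qed (auto intro!: continuous_intros)
  also have "cis (?a * 1) = 1"
    using cis_multiple_2pi[of "of_int k"] by simp
  finally show ?thesis using False by simp
qed simp

text \<open>By orthogonality of the characters, only the exponent m of the polynomial
  survives.\<close>

lemma integral_poly_cis:
  "(\<integral>t. poly p (cis (2 * pi * t)) / cis (2 * pi * t) ^ m \<partial>unit_interval) = coeff p m"
proof -
  have "poly p (cis (2 * pi * t)) / cis (2 * pi * t) ^ m
      = (\<Sum>i\<le>degree p. coeff p i * cis (2 * pi * of_int (int i - int m) * t))" for t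
    unfolding poly_altdef sum_divide_distrib
    by (intro sum.cong refl) (simp add: Complex.DeMoivre algebra_simps flip: cis_divide)
  moreover have "integrable unit_interval (\<lambda>t. coeff p i * cis (2 * pi * of_int (int i - int m) * t))" for i
    by (rule integrable_unit_interval_bounded[where b = "cmod (coeff p i)"])
       (auto simp: norm_mult intro!: measurable_restrict_space1 borel_measurable_continuous_onI continuous_intros)
  ultimately have "(\<integral>t. poly p (cis (2 * pi * t)) / cis (2 * pi * t) ^ m \<partial>unit_interval)
      = (\<Sum>i\<le>degree p. coeff p i * (if i = m then 1 else 0))"
    by (simp add: Bochner_Integration.integral_sum integral_cis del: of_int_diff)
  also have "\<dots> = (\<Sum>i\<le>degree p. if i = m then coeff p i else 0)"
    by (intro sum.cong) auto
  finally show ?thesis by (simp add: coeff_eq_0)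
qed

lemma mahler2_eq_integral_unit_interval:
  "mahler2 P = (\<integral>s. \<integral>t. ln (cmod (P (cis (2 * pi * s)) (cis (2 * pi * t)))) \<partial>unit_interval \<partial>unit_interval)"
  unfolding mahler2_def set_integral_unit_interval ..

text \<open>On Laurent polynomials this is the constant term.\<close>

definition torus_mean :: "(complex \<Rightarrow> complex \<Rightarrow> complex) \<Rightarrow> complex" where
  "torus_mean Q = (\<integral>s. \<integral>t. Q (cis (2 * pi * s)) (cis (2 * pi * t)) \<partial>unit_interval \<partial>unit_interval)"

text \<open>The polynomial factors as -(x y / z) (1 - z R / (x y)). On the torus the first factor
  has modulus 1 / |z|, and the second is handled by \<open>torus_log_series\<close>.\<close>

lemma mahler2_series:
  fixes R :: "complex \<Rightarrow> complex \<Rightarrow> complex" and z :: complex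
  assumes cont: "continuous_on UNIV (\<lambda>(x, y). R x y)"
    and bound: "\<And>x y. cmod x = 1 \<Longrightarrow> cmod y = 1 \<Longrightarrow> cmod (R x y) \<le> B"
    and z: "z \<noteq> 0" "cmod z * B < 1"
  shows "\<exists>S. (\<lambda>n. torus_mean (\<lambda>x y. (R x y / (x * y)) ^ n) / of_nat n * z ^ n) sums S
      \<and> mahler2 (\<lambda>x y. R x y - 1 / z * x * y) = - ln (cmod z) - Re S"
proof -
  interpret finite_measure unit_interval by (rule finite_measure_unit_interval)
  define q where "q = (\<lambda>s t. R (cis (2 * pi * s)) (cis (2 * pi * t)) / (cis (2 * pi * s) * cis (2 * pi * t)))"
  have cont': "continuous_on UNIV (\<lambda>(s, t). q s t)"
    unfolding q_def split_beta
    by (intro continuous_intros continuous_on_compose2[OF cont, of _ "\<lambda>p. (cis (2 * pi * fst p), cis (2 * pi * snd p))", simplified]) auto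
  have q_bound: "cmod (q s t) \<le> B" for s t
    by (simp add: q_def norm_divide norm_mult bound)
  define S where "S = - (\<integral>s. \<integral>t. Ln (1 - z * q s t) \<partial>unit_interval \<partial>unit_interval)"
  note series = torus_log_series[OF cont' q_bound z(2)]
  have "(\<lambda>n. torus_mean (\<lambda>x y. (R x y / (x * y)) ^ n) / of_nat n * z ^ n) sums S"
    using series(1) unfolding S_def torus_mean_def q_def .
  moreover have "mahler2 (\<lambda>x y. R x y - 1 / z * x * y) = - ln (cmod z) - Re S"
  proof -
    have nz: "1 - z * q s t \<noteq> 0" for s t
    proof
      assume "1 - z * q s t = 0"
      then have "cmod (z * q s t) = 1" by (metis eq_iff_diff_eq_0 norm_one)
      moreover have "cmod (z * q s t) \<le> cmod z * B"
        unfolding norm_mult by (intro mult_left_mono q_bound) auto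
      ultimately show False using z by simp
    qed
    have "R (cis (2 * pi * s)) (cis (2 * pi * t)) - 1 / z * cis (2 * pi * s) * cis (2 * pi * t)
        = - (1 / z) * (cis (2 * pi * s) * cis (2 * pi * t)) * (1 - z * q s t)" for s t
      using z by (simp add: q_def field_simps)
    then have "cmod (R (cis (2 * pi * s)) (cis (2 * pi * t)) - 1 / z * cis (2 * pi * s) * cis (2 * pi * t))
        = inverse (cmod z) * cmod (1 - z * q s t)" for s t
      by (simp add: norm_mult norm_inverse divide_inverse)
    then have "ln (cmod (R (cis (2 * pi * s)) (cis (2 * pi * t)) - 1 / z * cis (2 * pi * s) * cis (2 * pi * t)))
        = - ln (cmod z) + ln (cmod (1 - z * q s t))" for s t
      using z nz[of s t] by (simp add: ln_mult ln_inverse)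
    then have "mahler2 (\<lambda>x y. R x y - 1 / z * x * y)
        = (\<integral>s. \<integral>t. - ln (cmod z) + ln (cmod (1 - z * q s t)) \<partial>unit_interval \<partial>unit_interval)"
      unfolding mahler2_eq_integral_unit_interval by (simp only:)
    also have "\<dots> = - ln (cmod z) + (\<integral>s. \<integral>t. ln (cmod (1 - z * q s t)) \<partial>unit_interval \<partial>unit_interval)"
      using series(3,4) by simp
    finally show ?thesis unfolding series(2) S_def by simp
  qed
  ultimately show ?thesis by blast
qed

lemma coeff_linear_1_power: "coeff ([:a, 1:] ^ n) i = of_nat (n choose i) * (a :: complex) ^ (n - i)"
proof (cases "i \<le> n")
  case False
  have "degree ([:a, 1:] ^ n) \<le> n" by (rule order_trans[OF degree_power_le]) simp
  then show ?thesis using False by (simp add: coeff_eq_0 binomial_eq_0)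
qed (simp add: coeff_linear_poly_power)

text \<open>The coefficient of y^n in (x + y)^n (1 + y)^n is the sum of (n choose i)^2 x^(n - i).
  Multiplying by (1 + x)^n and taking the coefficient of x^n supplies the third binomial
  factor.\<close>

lemma torus_mean_franel:
  "torus_mean (\<lambda>x y. ((x + y) * (x + 1) * (y + 1) / (x * y)) ^ n) = franel_fps $ n"
proof -
  define p where "p = (\<lambda>x. [:x, 1:] ^ n * [:1, 1 :: complex:] ^ n)"
  define r :: "complex poly" where "r = [:1, 1:] ^ n * (\<Sum>i\<le>n. monom (of_nat ((n choose i) ^ 2)) (n - i))"
  have p_coeff: "coeff (p x) n = (\<Sum>i\<le>n. of_nat ((n choose i) ^ 2) * x ^ (n - i))" for x
    unfolding p_def coeff_mult
    by (intro sum.cong refl) (simp add: coeff_linear_1_power power2_eq_square binomial_symmetric[symmetric])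
  have "((x + y) * (x + 1) * (y + 1) / (x * y)) ^ n = (x + 1) ^ n / x ^ n * (poly (p x) y / y ^ n)" for x y
    by (simp add: p_def power_mult_distrib power_divide add.commute)
  then have "torus_mean (\<lambda>x y. ((x + y) * (x + 1) * (y + 1) / (x * y)) ^ n)
     = (\<integral>s. (cis (2 * pi * s) + 1) ^ n / cis (2 * pi * s) ^ n * coeff (p (cis (2 * pi * s))) n \<partial>unit_interval)"
    unfolding torus_mean_def by (simp only: integral_mult_right_zero integral_poly_cis)
  also have "\<dots> = (\<integral>s. poly r (cis (2 * pi * s)) / cis (2 * pi * s) ^ n \<partial>unit_interval)"
    by (simp add: p_coeff r_def poly_sum poly_monom add.commute)
  also have "\<dots> = coeff r n" by (rule integral_poly_cis)
  also have "r = (\<Sum>i\<le>n. monom (of_nat ((n choose i) ^ 2)) (n - i) * [:1, 1:] ^ n)"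
    unfolding r_def by (simp only: sum_distrib_left mult.commute)
  also have "coeff \<dots> n = (\<Sum>i\<le>n. of_nat ((n choose i) ^ 3))"
    unfolding coeff_sum by (intro sum.cong) (auto simp: coeff_monom_mult coeff_linear_1_power power2_eq_square power3_eq_cube)
  finally show ?thesis by (simp add: franel_fps_def)
qed

lemma coeff_monom_add_const_power:
  "coeff ((monom 1 3 + [:c:]) ^ n) m = (if 3 dvd m then of_nat (n choose (m div 3)) * (c :: complex) ^ (n - m div 3) else 0)"
proof -
  have "(monom 1 3 + [:c:]) ^ n = (\<Sum>k\<le>n. monom (of_nat (n choose k) * c ^ (n - k)) (3 * k))"
    unfolding binomial_ring
    by (intro sum.cong refl) (simp add: monom_power poly_const_pow of_nat_poly mult_monom monom_0[symmetric] mult.commute)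
  then have c: "coeff ((monom 1 3 + [:c:]) ^ n) m = (\<Sum>k\<le>n. if 3 * k = m then of_nat (n choose k) * c ^ (n - k) else 0)"
    by (simp add: coeff_sum)
  show ?thesis
  proof (cases "3 dvd m")
    case True
    then obtain j where m: "m = 3 * j" by auto
    have "coeff ((monom 1 3 + [:c:]) ^ n) m = (\<Sum>k\<le>n. if k = j then of_nat (n choose k) * c ^ (n - k) else 0)"
      unfolding m c[unfolded m] by (intro sum.cong) auto
    also have "\<dots> = of_nat (n choose j) * c ^ (n - j)"
      by (simp add: binomial_eq_0)
    finally show ?thesis by (simp add: m)
  qed (auto simp: c intro!: sum.neutral)
qed

text \<open>Only exponents of y divisible by 3 occur, so n = 3 j is forced. Then y^(3 j) has the
  coefficient (3 j choose j) (x^3 + 1)^(2 j), in which x^(3 j) has the coefficient (2 j choose j)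
  times the first factor.\<close>

lemma torus_mean_trinomial:
  "torus_mean (\<lambda>x y. ((x ^ 3 + y ^ 3 + 1) / (x * y)) ^ n) = (if 3 dvd n then trinomial_fps $ (n div 3) else 0)"
proof -
  define p where "p = (\<lambda>x :: complex. (monom 1 3 + [:x ^ 3 + 1:]) ^ n)"
  have "((x ^ 3 + y ^ 3 + 1) / (x * y)) ^ n = 1 / x ^ n * (poly (p x) y / y ^ n)" for x y
    by (simp add: p_def power_mult_distrib power_divide poly_monom add_ac)
  then have "torus_mean (\<lambda>x y. ((x ^ 3 + y ^ 3 + 1) / (x * y)) ^ n)
     = (\<integral>s. 1 / cis (2 * pi * s) ^ n * coeff (p (cis (2 * pi * s))) n \<partial>unit_interval)"
    unfolding torus_mean_def by (simp only: integral_mult_right_zero integral_poly_cis)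
  also have "\<dots> = (if 3 dvd n then trinomial_fps $ (n div 3) else 0)"
  proof (cases "3 dvd n")
    case True
    then obtain j where n: "n = 3 * j" by auto
    define r :: "complex poly" where "r = smult (of_nat (3 * j choose j)) ((monom 1 3 + [:1:]) ^ (2 * j))"
    have "(\<integral>s. 1 / cis (2 * pi * s) ^ n * coeff (p (cis (2 * pi * s))) n \<partial>unit_interval)
        = (\<integral>s. poly r (cis (2 * pi * s)) / cis (2 * pi * s) ^ n \<partial>unit_interval)"
      by (simp add: p_def coeff_monom_add_const_power n r_def poly_monom)
    also have "\<dots> = of_nat ((3 * j choose j) * (2 * j choose j))"
      unfolding integral_poly_cis by (simp add: r_def n coeff_monom_add_const_power)
    also have "\<dots> = trinomial_fps $ j"
      using binomial_fact[of j "3 * j", where ?'a = complex] binomial_fact[of j "2 * j", where ?'a = complex]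
      by (simp add: trinomial_fps_def power3_eq_cube)
    finally show ?thesis by (simp add: n)
  qed (simp add: p_def coeff_monom_add_const_power)
  finally show ?thesis .
qed

text \<open>Each of the three linear factors has modulus at most 2 on the torus, whence the bound
  1/8.\<close>

lemma g_fun_series:
  assumes "t \<noteq> 0" "cmod t < 1 / 8"
  shows "\<exists>S. (\<lambda>n. fps_logint franel_fps $ n * t ^ n) sums S \<and> g_fun t = - ln (cmod t) - Re S"
  unfolding g_fun_def fps_logint_def fps_nth_Abs_fps torus_mean_franel[symmetric]
proof (rule mahler2_series)
  show "continuous_on UNIV (\<lambda>(x, y). (x + y) * (x + 1) * (y + 1) :: complex)"
    unfolding split_beta by (intro continuous_intros)
  fix x y :: complex assume "cmod x = 1" "cmod y = 1"
  then have "cmod (x + y) \<le> 2" "cmod (x + 1) \<le> 2" "cmod (y + 1) \<le> 2"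
    using norm_triangle_ineq[of x y] norm_triangle_ineq[of x 1] norm_triangle_ineq[of y 1] by auto
  then have "cmod (x + y) * cmod (x + 1) * cmod (y + 1) \<le> 2 * 2 * 2"
    by (intro mult_mono) auto
  then show "cmod ((x + y) * (x + 1) * (y + 1)) \<le> 8" by (simp add: norm_mult)
qed (use assms in auto)

text \<open>The chosen z is a cube root of t with 1 / z = 3 / (27 t)^(1/3). On the torus x^3 + y^3 +
  1 has modulus at most 3, so |z| < 1/3 suffices, that is |t| < 1/27.\<close>

lemma n_fun_series:
  assumes "t \<noteq> 0" "cmod t < 1 / 27"
  shows "\<exists>S. (\<lambda>n. fps_logint trinomial_fps $ n * t ^ n) sums S \<and> n_fun (27 * t) = - (ln (cmod t) + Re S) / 3"
proof -
  define z where "z = (27 * t) powr (1 / 3) / 3"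
  have z3: "z ^ 3 = t"
  proof -
    have "((27 * t) powr (1 / 3)) ^ 3 = 27 * t"
      using assms by (simp add: powr_def exp_of_nat_mult[symmetric])
    then show ?thesis by (simp add: z_def power_divide)
  qed
  have z0: "z \<noteq> 0" using z3 assms by auto
  have "cmod z ^ 3 < (1 / 3) ^ 3"
    using assms unfolding norm_power[symmetric] z3 by (simp add: power3_eq_cube)
  then have z1: "cmod z < 1 / 3"
    by (rule power_less_imp_less_base) simp
  have ln_z: "ln (cmod t) = 3 * ln (cmod z)"
    using z0 unfolding z3[symmetric] by (simp add: norm_power ln_realpow)
  have "\<exists>S. (\<lambda>n. torus_mean (\<lambda>x y. ((x ^ 3 + y ^ 3 + 1) / (x * y)) ^ n) / of_nat n * z ^ n) sums S
      \<and> mahler2 (\<lambda>x y. x ^ 3 + y ^ 3 + 1 - 1 / z * x * y) = - ln (cmod z) - Re S"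
  proof (rule mahler2_series)
    show "continuous_on UNIV (\<lambda>(x, y). x ^ 3 + y ^ 3 + 1 :: complex)"
      unfolding split_beta by (intro continuous_intros)
    fix x y :: complex assume "cmod x = 1" "cmod y = 1"
    then show "cmod (x ^ 3 + y ^ 3 + 1) \<le> 3"
      using norm_triangle_ineq[of "x ^ 3 + y ^ 3" 1] norm_triangle_ineq[of "x ^ 3" "y ^ 3"] by (simp add: norm_power)
  qed (use z0 z1 in auto)
  then obtain S where S: "(\<lambda>n. (if 3 dvd n then trinomial_fps $ (n div 3) else 0) / of_nat n * z ^ n) sums S"
    and n: "mahler2 (\<lambda>x y. x ^ 3 + y ^ 3 + 1 - 1 / z * x * y) = - ln (cmod z) - Re S"
    unfolding torus_mean_trinomial by blast
  \<comment> \<open>Only indices n = 3 j contribute, which turns the series in z into one in t =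
    z^3; the denominators 3 j account for the factor 1/3.\<close>
  have "(\<lambda>j. trinomial_fps $ j / of_nat (3 * j) * z ^ (3 * j)) sums S"
    using S by (subst (asm) sums_mono_reindex[of "\<lambda>j. 3 * j", symmetric]) (auto simp: strict_mono_def)
  then have "(\<lambda>j. 3 * (trinomial_fps $ j / of_nat (3 * j) * z ^ (3 * j))) sums (3 * S)"
    by (rule sums_mult)
  then have "(\<lambda>n. fps_logint trinomial_fps $ n * t ^ n) sums (3 * S)"
    by (simp add: fps_logint_def power_mult z3)
  moreover have "n_fun (27 * t) = - (ln (cmod t) + Re (3 * S)) / 3"
  proof -
    have "n_fun (27 * t) = mahler2 (\<lambda>x y. x ^ 3 + y ^ 3 + 1 - 1 / z * x * y)"
      by (simp add: n_fun_def z_def)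
    then show ?thesis unfolding n ln_z by simp
  qed
  ultimately show ?thesis by blast
qed

subsection \<open>The functional equations\<close>

lemma has_fps_expansion_Ln: "(\<lambda>z. Ln (1 + z)) has_fps_expansion fps_ln 1"
proof (rule has_fps_expansionI)
  have "eventually (\<lambda>z::complex. cmod z < 1) (nhds 0)"
    using eventually_nhds_in_open[of "ball 0 1" "0 :: complex"] by simp
  then show "\<forall>\<^sub>F z in nhds 0. (\<lambda>n. fps_nth (fps_ln 1) n * z ^ n) sums Ln (1 + z)"
  proof eventually_elim
    case (elim z)
    have "(\<lambda>n. (- 1) ^ Suc n / of_nat n * z ^ n) = (\<lambda>n. fps_nth (fps_ln 1) n * z ^ n)"
    proof
      fix n show "(- 1) ^ Suc n / of_nat n * z ^ n = fps_nth (fps_ln 1) n * z ^ n"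
        by (cases n) (simp_all add: fps_ln_def)
    qed
    then show ?case using Ln_series[OF elim] by simp
  qed
qed

lemma has_fps_expansion_eval_fpsI:
  fixes L :: "complex fps"
  assumes "r > 0" "\<And>t. t \<noteq> 0 \<Longrightarrow> cmod t < r \<Longrightarrow> summable (\<lambda>n. L $ n * t ^ n)"
  shows "eval_fps L has_fps_expansion L"
proof -
  have "ereal (cmod (of_real (r / 2))) \<le> conv_radius (fps_nth L)"
    using assms by (intro conv_radius_geI) auto
  moreover have "cmod (of_real (r / 2)) > 0" using assms by simp
  ultimately have "fps_conv_radius L > 0"
    unfolding fps_conv_radius_def using less_le_trans by (metis ereal_less(2))
  then show ?thesis unfolding has_fps_expansion_def by simp
qed

definition "franel_log = eval_fps (fps_logint franel_fps)"
definition "trinomial_log = eval_fps (fps_logint trinomial_fps)"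

lemma g_fun_eq: "t \<noteq> 0 \<Longrightarrow> cmod t < 1 / 8 \<Longrightarrow> g_fun t = - ln (cmod t) - Re (franel_log t)"
  using g_fun_series[of t] by (auto simp: franel_log_def eval_fps_def sums_iff)

lemma n_fun_eq: "t \<noteq> 0 \<Longrightarrow> cmod t < 1 / 27 \<Longrightarrow> n_fun (27 * t) = - (ln (cmod t) + Re (trinomial_log t)) / 3"
  using n_fun_series[of t] by (auto simp: trinomial_log_def eval_fps_def sums_iff)

text \<open>The positive radius of convergence comes from the summability contained in
  \<open>g_fun_series\<close>, without an estimate of the coefficients.\<close>

lemma franel_log_expansion: "franel_log has_fps_expansion fps_logint franel_fps"
  unfolding franel_log_def
  by (rule has_fps_expansion_eval_fpsI[of "1 / 8"], simp) (metis g_fun_series sums_summable)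

lemma trinomial_log_expansion: "trinomial_log has_fps_expansion fps_logint trinomial_fps"
  unfolding trinomial_log_def
  by (rule has_fps_expansion_eval_fpsI[of "1 / 27"], simp) (metis n_fun_series sums_summable)

lemma log_identity_1:
  "eventually (\<lambda>p. 9 * franel_log p - trinomial_log (p * inverse (1 + 4 * p) ^ 3)
     - 4 * trinomial_log (p ^ 2 * inverse (1 - 2 * p) ^ 3)
     + 3 * Ln (1 + 4 * p) + 12 * Ln (1 + (- (2 * p))) = 0) (nhds 0)"
proof -
  have "(\<lambda>p. 9 * franel_log p - (trinomial_log \<circ> (\<lambda>p. p * inverse (1 + 4 * p) ^ 3)) p
     - 4 * (trinomial_log \<circ> (\<lambda>p. p ^ 2 * inverse (1 - 2 * p) ^ 3)) p
     + 3 * ((\<lambda>z. Ln (1 + z)) \<circ> (\<lambda>p. 4 * p)) p + 12 * ((\<lambda>z. Ln (1 + z)) \<circ> (\<lambda>p. - (2 * p))) p)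
    has_fps_expansion 0"
    \<comment> \<open>The zero series is replaced by the combination that equals it, which is then
      matched with the function term by term.\<close>
    unfolding fps_logint_identity_1[symmetric]
    by (intro has_fps_expansion_add has_fps_expansion_diff has_fps_expansion_mult has_fps_expansion_power
        has_fps_expansion_inverse has_fps_expansion_minus has_fps_expansion_fps_X has_fps_expansion_numeral
        has_fps_expansion_1 has_fps_expansion_compose franel_log_expansion trinomial_log_expansion
        has_fps_expansion_Ln) (simp_all add: numeral_fps_const)
  then show ?thesis unfolding has_fps_expansion_0_iff by simp
qed

lemma log_identity_2:
  "eventually (\<lambda>u. trinomial_log (1 / 2 * u * (1 + u) ^ 4 * inverse (1 + 4 * u + u ^ 2) ^ 3)
     - franel_log (1 / 2 * u * inverse (1 + u) ^ 2) + 8 * franel_log (- (1 / 2 * u * (1 + u)))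
     - 4 * franel_log ((1 / 2) ^ 2 * u ^ 2 * inverse (1 + u))
     + 18 * Ln (1 + u) - 3 * Ln (1 + (4 * u + u ^ 2)) = 0) (nhds 0)"
proof -
  have "(\<lambda>u. (trinomial_log \<circ> (\<lambda>u. 1 / 2 * u * (1 + u) ^ 4 * inverse (1 + 4 * u + u ^ 2) ^ 3)) u
     - (franel_log \<circ> (\<lambda>u. 1 / 2 * u * inverse (1 + u) ^ 2)) u + 8 * (franel_log \<circ> (\<lambda>u. - (1 / 2 * u * (1 + u)))) u
     - 4 * (franel_log \<circ> (\<lambda>u. (1 / 2) ^ 2 * u ^ 2 * inverse (1 + u))) u
     + 18 * ((\<lambda>z. Ln (1 + z)) \<circ> (\<lambda>u. u)) u - 3 * ((\<lambda>z. Ln (1 + z)) \<circ> (\<lambda>u. 4 * u + u ^ 2)) u)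
    has_fps_expansion 0"
    unfolding fps_logint_identity_2[symmetric]
    by (intro has_fps_expansion_add has_fps_expansion_diff has_fps_expansion_mult has_fps_expansion_power
        has_fps_expansion_inverse has_fps_expansion_minus has_fps_expansion_fps_X has_fps_expansion_numeral
        has_fps_expansion_1 has_fps_expansion_const has_fps_expansion_compose franel_log_expansion
        trinomial_log_expansion has_fps_expansion_Ln) (simp_all add: numeral_fps_const)
  then show ?thesis unfolding has_fps_expansion_0_iff by simp
qed

section \<open>Real parts near zero\<close>

lemma eventually_cmod_less:
  fixes f :: "complex \<Rightarrow> complex"
  assumes "isCont f 0" "f 0 = 0" "r > 0"
  shows "eventually (\<lambda>z. cmod (f z) < r) (nhds 0)"
proof -
  have "eventually (\<lambda>z. dist (f z) 0 < r) (at 0)"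
    using assms by (intro tendstoD) (simp_all add: isCont_def)
  then show ?thesis using assms(2,3) by (simp add: eventually_nhds_conv_at)
qed

lemma eventually_nonzero:
  fixes f :: "complex \<Rightarrow> complex"
  assumes "isCont f 0" "f 0 = 1"
  shows "eventually (\<lambda>z. f z \<noteq> 0) (nhds 0)"
  using eventually_cmod_less[of "\<lambda>z. f z - 1" 1] assms
  by (auto intro!: continuous_intros elim!: eventually_mono)

lemma eventually_nhds_0_imp_punctured_ball:
  assumes "\<forall>\<^sub>F z in nhds (0 :: complex). z \<noteq> 0 \<longrightarrow> P z"
  shows "\<exists>\<epsilon>>0. \<forall>z. 0 < cmod z \<and> cmod z < \<epsilon> \<longrightarrow> P z"
  using assms unfolding eventually_nhds_metric by (simp add: dist_norm) blast

text \<open>Only real parts of logarithms enter, so no branch has to be followed: the formulas for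
  ln |s1| and ln |s2| reduce the claim to the real part of \<open>log_identity_1\<close>.\<close>

lemma mahler_identity_1:
  "\<forall>\<^sub>F p in nhds 0. p \<noteq> 0 \<longrightarrow>
      3 * g_fun p = n_fun (27 * p / (1 + 4 * p)^3) + 4 * n_fun (27 * p^2 / (1 - 2 * p)^3)"
proof -
  have "\<forall>\<^sub>F p in nhds (0 :: complex). cmod p < 1 / 8"
    "\<forall>\<^sub>F p in nhds (0 :: complex). cmod (p * inverse (1 + 4 * p) ^ 3) < 1 / 27"
    "\<forall>\<^sub>F p in nhds (0 :: complex). cmod (p ^ 2 * inverse (1 - 2 * p) ^ 3) < 1 / 27"
    by (rule eventually_cmod_less; (auto intro!: continuous_intros)[1])+
  moreover have "\<forall>\<^sub>F p in nhds (0 :: complex). 1 + 4 * p \<noteq> 0" "\<forall>\<^sub>F p in nhds (0 :: complex). 1 - 2 * p \<noteq> 0"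
    by (rule eventually_nonzero; (auto intro!: continuous_intros)[1])+
  ultimately show ?thesis using log_identity_1
  proof eventually_elim
    case (elim p)
    show ?case
    proof
      assume p0: "p \<noteq> 0"
      define s1 s2 where "s1 = p * inverse (1 + 4 * p) ^ 3" and "s2 = p ^ 2 * inverse (1 - 2 * p) ^ 3"
      have s0: "s1 \<noteq> 0" "s2 \<noteq> 0" using p0 elim by (simp_all add: s1_def s2_def)
      have l1: "ln (cmod s1) = ln (cmod p) - 3 * ln (cmod (1 + 4 * p))"
        unfolding s1_def norm_mult norm_power norm_inverse
        using p0 elim by (simp add: ln_mult ln_realpow ln_inverse)
      have l2: "ln (cmod s2) = 2 * ln (cmod p) - 3 * ln (cmod (1 - 2 * p))"
        unfolding s2_def norm_mult norm_power norm_inverse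
        using p0 elim by (simp add: ln_mult ln_realpow ln_inverse)
      have n1: "n_fun (27 * p / (1 + 4 * p)^3) = - (ln (cmod s1) + Re (trinomial_log s1)) / 3"
        using n_fun_eq[of s1] s0 elim(2) by (simp add: s1_def field_simps)
      have n2: "n_fun (27 * p^2 / (1 - 2 * p)^3) = - (ln (cmod s2) + Re (trinomial_log s2)) / 3"
        using n_fun_eq[of s2] s0 elim(3) by (simp add: s2_def field_simps)
      have g: "g_fun p = - ln (cmod p) - Re (franel_log p)"
        using g_fun_eq[of p] p0 elim(1) by simp
      have "Re (9 * franel_log p - trinomial_log s1 - 4 * trinomial_log s2
          + 3 * Ln (1 + 4 * p) + 12 * Ln (1 + (- (2 * p)))) = 0"
        using p0 elim unfolding s1_def s2_def by simp
      then have "9 * Re (franel_log p) - Re (trinomial_log s1) - 4 * Re (trinomial_log s2)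
          + 3 * ln (cmod (1 + 4 * p)) + 12 * ln (cmod (1 - 2 * p)) = 0"
        using p0 elim by (simp add: Re_Ln)
      then show "3 * g_fun p = n_fun (27 * p / (1 + 4 * p)^3) + 4 * n_fun (27 * p^2 / (1 - 2 * p)^3)"
        unfolding n1 n2 g l1 l2 by (simp add: field_simps)
    qed
  qed
qed

text \<open>Near zero all four arguments lie within the ranges of the series. The contributions of
  ln (1/2) and ln |u| cancel, and the real part of \<open>log_identity_2\<close> gives the
  rest.\<close>

lemma mahler_identity_2:
  "\<forall>\<^sub>F u in nhds 0. u \<noteq> 0 \<longrightarrow>
      3 * n_fun (27 * u * (1 + u)^4 / (2 * (1 + 4 * u + u^2)^3))
        = g_fun (u / (2 * (1 + u)^2)) - 8 * g_fun (- (u * (1 + u) / 2)) + 4 * g_fun (u^2 / (4 * (1 + u)))"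
proof -
  have "\<forall>\<^sub>F u in nhds (0 :: complex). cmod (1 / 2 * u * (1 + u) ^ 4 * inverse (1 + 4 * u + u ^ 2) ^ 3) < 1 / 27"
    "\<forall>\<^sub>F u in nhds (0 :: complex). cmod (1 / 2 * u * inverse (1 + u) ^ 2) < 1 / 8"
    "\<forall>\<^sub>F u in nhds (0 :: complex). cmod (- (1 / 2 * u * (1 + u))) < 1 / 8"
    "\<forall>\<^sub>F u in nhds (0 :: complex). cmod ((1 / 2) ^ 2 * u ^ 2 * inverse (1 + u)) < 1 / 8"
    by (rule eventually_cmod_less; (auto intro!: continuous_intros)[1])+
  moreover have "\<forall>\<^sub>F u in nhds (0 :: complex). 1 + u \<noteq> 0"
    "\<forall>\<^sub>F u in nhds (0 :: complex). 1 + 4 * u + u ^ 2 \<noteq> 0"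
    by (rule eventually_nonzero; (auto intro!: continuous_intros)[1])+
  ultimately show ?thesis using log_identity_2
  proof eventually_elim
    case (elim u)
    show ?case
    proof
      assume u0: "u \<noteq> 0"
      define s p1 p2 p3 where "s = 1 / 2 * u * (1 + u) ^ 4 * inverse (1 + 4 * u + u ^ 2) ^ 3"
        and "p1 = 1 / 2 * u * inverse (1 + u) ^ 2" and "p2 = - (1 / 2 * u * (1 + u))"
        and "p3 = (1 / 2) ^ 2 * u ^ 2 * inverse (1 + u)"
      have nz: "s \<noteq> 0" "p1 \<noteq> 0" "p2 \<noteq> 0" "p3 \<noteq> 0"
        using u0 elim by (simp_all add: s_def p1_def p2_def p3_def)
      have ls: "ln (cmod s) = ln (1 / 2) + ln (cmod u) + 4 * ln (cmod (1 + u)) - 3 * ln (cmod (1 + 4 * u + u ^ 2))"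
        unfolding s_def norm_mult norm_power norm_inverse
        using u0 elim by (simp add: ln_mult ln_realpow ln_inverse norm_divide ln_div)
      have l1: "ln (cmod p1) = ln (1 / 2) + ln (cmod u) - 2 * ln (cmod (1 + u))"
        unfolding p1_def norm_mult norm_power norm_inverse
        using u0 elim by (simp add: ln_mult ln_realpow ln_inverse norm_divide ln_div)
      have l2: "ln (cmod p2) = ln (1 / 2) + ln (cmod u) + ln (cmod (1 + u))"
        unfolding p2_def norm_minus_cancel norm_mult
        using u0 elim by (simp add: ln_mult norm_divide ln_div)
      have ln4: "ln (4 :: real) = 2 * ln 2"
        using ln_realpow[of 2 2] by simp
      have l3: "ln (cmod p3) = 2 * ln (1 / 2) + 2 * ln (cmod u) - ln (cmod (1 + u))"
        unfolding p3_def norm_mult norm_power norm_inverse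
        using u0 elim by (simp add: ln_mult ln_realpow ln_inverse norm_divide ln_div power_one_over ln4)
      have n: "n_fun (27 * u * (1 + u)^4 / (2 * (1 + 4 * u + u^2)^3)) = - (ln (cmod s) + Re (trinomial_log s)) / 3"
        using n_fun_eq[of s] nz elim(1) by (simp add: s_def field_simps)
      have g1: "g_fun (u / (2 * (1 + u)^2)) = - ln (cmod p1) - Re (franel_log p1)"
        using g_fun_eq[of p1] nz elim(2) by (simp add: p1_def field_simps)
      have g2: "g_fun (- (u * (1 + u) / 2)) = - ln (cmod p2) - Re (franel_log p2)"
        using g_fun_eq[of p2] nz elim(3) by (simp add: p2_def)
      have g3: "g_fun (u^2 / (4 * (1 + u))) = - ln (cmod p3) - Re (franel_log p3)"
        using g_fun_eq[of p3] nz elim(4) by (simp add: p3_def field_simps)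
      have "Re (trinomial_log s - franel_log p1 + 8 * franel_log p2 - 4 * franel_log p3
          + 18 * Ln (1 + u) - 3 * Ln (1 + (4 * u + u ^ 2))) = 0"
        using u0 elim unfolding s_def p1_def p2_def p3_def by simp
      then have "Re (trinomial_log s) - Re (franel_log p1) + 8 * Re (franel_log p2) - 4 * Re (franel_log p3)
          + 18 * ln (cmod (1 + u)) - 3 * ln (cmod (1 + 4 * u + u ^ 2)) = 0"
        using u0 elim by (simp add: Re_Ln add.assoc)
      then show "3 * n_fun (27 * u * (1 + u)^4 / (2 * (1 + 4 * u + u^2)^3))
          = g_fun (u / (2 * (1 + u)^2)) - 8 * g_fun (- (u * (1 + u) / 2)) + 4 * g_fun (u^2 / (4 * (1 + u)))"
        unfolding n g1 g2 g3 ls l1 l2 l3 by simp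
    qed
  qed
qed

theorem mainTheorem10:
  shows "(\<exists>\<epsilon>>0. \<forall>p::complex. 0 < cmod p \<and> cmod p < \<epsilon> \<longrightarrow>
            3 * g_fun p = n_fun (27 * p / (1 + 4 * p)^3) + 4 * n_fun (27 * p^2 / (1 - 2 * p)^3))
       \<and> (\<exists>\<epsilon>>0. \<forall>u::complex. 0 < cmod u \<and> cmod u < \<epsilon> \<longrightarrow>
            3 * n_fun (27 * u * (1 + u)^4 / (2 * (1 + 4 * u + u^2)^3))
              = g_fun (u / (2 * (1 + u)^2)) - 8 * g_fun (- (u * (1 + u) / 2))
                + 4 * g_fun (u^2 / (4 * (1 + u))))"
  by (intro conjI eventually_nhds_0_imp_punctured_ball mahler_identity_1 mahler_identity_2)

end
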